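(* The group of all orthogonal transformations of $V$ that map the Optimism Code $\mathcal{OC}$ onto itself is exactly the Optimism Group $\mathcal{OG}$, and $\mathcal{OG}$ has shape $2^{1+8}_+GL(4,2)$ (that is, $O_2(\mathcal{OG})$ is an extraspecial group of order $2^9$ of plus type and $\mathcal{OG}/O_2(\mathcal{OG})\cong GL(4,2)$).
   Context: Let $\Omega=\mathbb{F}_2^4$ and let $V=\mathbb{R}^{16}$ with orthonormal basis $(v_\omega)_{\omega\in\Omega}$ and the standard inner product; put $x_0=\sum_{\omega\in\Omega}v_\omega$. For $A\subseteq\Omega$ let $\varepsilon_A$ be the orthogonal map with $v_\omega\mapsto -v_\omega$ for $\omega\in A$ and $v_\omega\mapsto v_\omega$ for $\omega\notin A$. Subsets of $\Omega$ are identified with binary words, addition being symmetric difference. $RM(1,4)\subset RM(2,4)$ are the binary Reed–Muller codes on $\Omega$: $RM(r,4)$ is spanned by the affine subspaces of $\Omega$ of codimension $r$ (so $RM(1,4)$ consists of $\emptyset$, $\Omega$ and the 30 affine hyperplanes). Let $D=\{\varepsilon_A: A\in RM(2,4)\}\cong 2^{11}$ and $D_1=\{\varepsilon_A:A\in RM(1,4)\}\cong 2^5$. Let $P\cong AGL(4,2)$ be the group of affine bijections of $\Omega$, acting on $V$ by the permutation matrices $v_\omega\mapsto v_{\omega g}$ (groups act on the right); let $T$ be its translation subgroup and $P_0\cong GL(4,2)$ the stabilizer of $0$. $P$ normalizes $D$ and $D_1$ (conjugation $d^x=x^{-1}dx$), so $D/D_1$ is a 6-dimensional $\mathbb{F}_2P$-module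 on which $T$ acts trivially. Fix a map $f:P\to D$ such that the composite $\bar f:P\to D/D_1$ satisfies $\bar f(xy)=\bar f(x)\,\bar f(y)^{x^{-1}}$, chosen as follows: identify $P/T\cong GL(4,2)\cong Alt_8$ and identify $D/D_1$ with the 6-dimensional module (even subsets of $\{1,\dots,8\}$ modulo $\{\emptyset,\{1,\dots,8\}\}$); set $\bar f(g)=$ the class of $\{1\}+\{1g\}$. Its kernel $K=\{g\in P:\bar f(g)=1\}$ is a subgroup of $P$ isomorphic to $2^4{:}Alt_7$. The Optimism Group is $\mathcal{OG}=\{d\,f(x)\,x: d\in D_1, x\in P\}$ (a subgroup of $DP$), and the Optimism Code is $\mathcal{OC}=\{x_0g:g\in\mathcal{OG}\}$, a set of 256 vectors of norm 16 (rescaling by $\tfrac14$ gives a spherical code).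
   Formalization: With groups acting on the right, the formula {1}+{1g} contradicts the required identity for the map f̄ on products; the formal statement lets the permutations of {1,…,8} act from the left, which amounts to taking f̄(g) to be the class of {1}+{1g⁻¹}. *)

theory Defs
  imports "HOL-Analysis.Analysis" "HOL-Algebra.Sym_Groups" "HOL-Library.Z2"
begin
definition group_center :: "('a, 'b) monoid_scheme \<Rightarrow> 'a set" where
  "group_center G =
     {z \<in> carrier G. \<forall>x\<in>carrier G. z \<otimes>\<^bsub>G\<^esub> x = x \<otimes>\<^bsub>G\<^esub> z}"

definition elementary_abelian :: "nat \<Rightarrow> ('a, 'b) monoid_scheme \<Rightarrow> bool" where
  "elementary_abelian p G \<longleftrightarrow>
     comm_group G \<and> (\<forall>x\<in>carrier G. x [^]\<^bsub>G\<^esub> p = \<one>\<^bsub>G\<^esub>)"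

definition extraspecial :: "nat \<Rightarrow> ('a, 'b) monoid_scheme \<Rightarrow> bool" where
  "extraspecial p G \<longleftrightarrow>
     prime p \<and> group G \<and> (\<exists>k. order G = p ^ k) \<and>
     card (group_center G) = p \<and>
     order (G Mod group_center G) > 1 \<and>
     elementary_abelian p (G Mod group_center G)"

text \<open>For an extraspecial 2-group \<open>G\<close> of order \<open>2 ^ (1 + 2 * n)\<close>, squaring induces a
  quadratic form on \<open>G/Z(G)\<close> with values in \<open>Z(G)\<close>.  Plus type means that this form has maximal
  Witt index, i.e. there is a totally singular subspace \<open>W\<close> of dimension \<open>n\<close>.\<close>

definition plus_type :: "('a, 'b) monoid_scheme \<Rightarrow> bool" where
  "plus_type G \<longleftrightarrow>
     (\<exists>n W. order G = 2 ^ (1 + 2 * n) \<and>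
            subgroup W (G Mod group_center G) \<and> card W = 2 ^ n \<and>
            (\<forall>X\<in>W. \<forall>x\<in>X. x \<otimes>\<^bsub>G\<^esub> x = \<one>\<^bsub>G\<^esub>))"

text \<open>For finite \<open>G\<close> this is \<open>O\<^sub>p(G)\<close>, the largest normal \<open>p\<close>-subgroup.\<close>

definition p_core :: "nat \<Rightarrow> ('a, 'b) monoid_scheme \<Rightarrow> 'a set" where
  "p_core p G = generate G (\<Union>{N. N \<lhd> G \<and> (\<exists>k. card N = p ^ k)})"

instance bit :: finite
proof
  have "(UNIV :: bit set) = {0, 1}"
    by (auto intro: bit.exhaust)
  then show "finite (UNIV :: bit set)"
    by (metis finite.emptyI finite_insert)
qed

type_synonym point = "bit ^ 4"
type_synonym V = "real ^ point"

text \<open>Groups act on the right: the product of \<open>g\<close> and \<open>h\<close> is ``first \<open>g\<close>, then \<open>h\<close>''.\<close>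

definition orth_group :: "(V \<Rightarrow> V) monoid" where
  "orth_group =
     \<lparr>carrier = {h. orthogonal_transformation h}, mult = (\<lambda>g h. h \<circ> g), one = id\<rparr>"

definition AGL42 :: "(point \<Rightarrow> point) monoid" where
  "AGL42 =
     \<lparr>carrier = {g. bij g \<and> (\<exists>(M :: bit^4^4) b. \<forall>\<omega>. g \<omega> = \<omega> v* M + b)},
      mult = (\<lambda>g h. h \<circ> g), one = id\<rparr>"

definition translation_subgroup :: "(point \<Rightarrow> point) set" where
  "translation_subgroup = range (\<lambda>a \<omega>. \<omega> + a)"

definition GL42 :: "(bit^4^4) monoid" where
  "GL42 = \<lparr>carrier = {M. invertible M}, mult = (**), one = mat 1\<rparr>"

definition x0 :: V where
  "x0 = (\<Sum>\<omega>\<in>UNIV. axis \<omega> 1)"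

definition eps :: "point set \<Rightarrow> V \<Rightarrow> V" where
  "eps A x = (\<chi> \<omega>. if \<omega> \<in> A then - (x $ \<omega>) else x $ \<omega>)"

definition perm_map :: "(point \<Rightarrow> point) \<Rightarrow> V \<Rightarrow> V" where
  "perm_map g x = (\<Sum>\<omega>\<in>UNIV. (x $ \<omega>) *\<^sub>R axis (g \<omega>) 1)"

lemma eps_axis: "eps A (axis \<omega> 1) = (if \<omega> \<in> A then - axis \<omega> 1 else axis \<omega> 1)"
  by (rule vec_eq_iff [THEN iffD2]) (auto simp: eps_def axis_def)

lemma perm_map_axis: "perm_map g (axis \<omega> 1) = axis (g \<omega>) 1"
proof -
  have "perm_map g (axis \<omega> 1) = (\<Sum>\<nu>\<in>UNIV. if \<nu> = \<omega> then axis (g \<nu>) 1 else 0)"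
    unfolding perm_map_def by (rule sum.cong) (auto simp: axis_def)
  then show ?thesis
    by simp
qed

definition affine_subspaces :: "nat \<Rightarrow> point set set" where
  "affine_subspaces r =
     {(+) a ` W | a W. vec.subspace W \<and> vec.dim W + r = CARD(4)}"

definition word :: "point set \<Rightarrow> bit ^ point" where
  "word A = (\<chi> \<omega>. if \<omega> \<in> A then 1 else 0)"

definition RM :: "nat \<Rightarrow> point set set" where
  "RM r = {A. word A \<in> vec.span (word ` affine_subspaces r)}"

definition D :: "(V \<Rightarrow> V) set" where
  "D = eps ` RM 2"

definition D1 :: "(V \<Rightarrow> V) set" where
  "D1 = eps ` RM 1"

definition D_mod_D1 :: "(V \<Rightarrow> V) set monoid" where
  "D_mod_D1 = (orth_group\<lparr>carrier := D\<rparr>) Mod D1"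

definition even_subsets :: "nat set monoid" where
  "even_subsets = \<lparr>carrier = {E. E \<subseteq> {1..8} \<and> even (card E)}, mult = sym_diff, one = {}\<rparr>"

definition even_class :: "nat set \<Rightarrow> nat set set" where
  "even_class E = {{}, {1..8}} #>\<^bsub>even_subsets\<^esub> E"

definition even_module :: "nat set set monoid" where
  "even_module = even_subsets Mod {{}, {1..8}}"

text \<open>An identification \<open>\<phi>\<close> of \<open>P/T\<close> with \<open>Alt\<^sub>8\<close>.  The product in \<^const>\<open>alt_group\<close> is
  \<open>(\<circ>)\<close>, so \<open>alt_act \<phi> (xy) = alt_act \<phi> x \<circ> alt_act \<phi> y\<close>: the points \<open>1, ..., 8\<close> are
  acted on from the left.\<close>

definition alt_identification :: "((point \<Rightarrow> point) set \<Rightarrow> nat \<Rightarrow> nat) \<Rightarrow> bool" where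
  "alt_identification \<phi> \<longleftrightarrow> \<phi> \<in> iso (AGL42 Mod translation_subgroup) (alt_group 8)"

definition alt_act ::
  "((point \<Rightarrow> point) set \<Rightarrow> nat \<Rightarrow> nat) \<Rightarrow> (point \<Rightarrow> point) \<Rightarrow> nat \<Rightarrow> nat" where
  "alt_act \<phi> g = \<phi> (translation_subgroup #>\<^bsub>AGL42\<^esub> g)"

text \<open>An identification \<open>\<psi>\<close> of the module \<open>D/D\<^sub>1\<close>, compatible with \<open>\<phi>\<close>.  The left action of
  \<open>x \<in> P\<close> on \<open>D\<close> that goes with the left action on points is \<open>d \<mapsto> x d x\<^sup>-\<^sup>1\<close>, which is the
  right action of the inverse of \<open>x\<close>.\<close>

definition module_identification ::
  "((point \<Rightarrow> point) set \<Rightarrow> nat \<Rightarrow> nat) \<Rightarrow> ((V \<Rightarrow> V) set \<Rightarrow> nat set set) \<Rightarrow> bool" where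
  "module_identification \<phi> \<psi> \<longleftrightarrow>
     \<psi> \<in> iso D_mod_D1 even_module \<and>
     (\<forall>x\<in>carrier AGL42. \<forall>d\<in>D.
        \<psi> (D1 #>\<^bsub>orth_group\<^esub>
             (perm_map x \<otimes>\<^bsub>orth_group\<^esub> d \<otimes>\<^bsub>orth_group\<^esub> inv\<^bsub>orth_group\<^esub> (perm_map x)))
        = (\<lambda>E. alt_act \<phi> x ` E) ` \<psi> (D1 #>\<^bsub>orth_group\<^esub> d))"

text \<open>The requirements on the map \<open>f\<close> from \<open>P\<close> to \<open>D\<close>: the cocycle identity
  \<open>f(xy) = f(x) f(y)\<^sup>x\<^sup>-\<^sup>1\<close> modulo \<open>D\<^sub>1\<close>, and \<open>f(g)\<close> corresponds to the class of
  \<open>{1} + {g(1)}\<close>.  With the points acted on from the left, as above, the second property implies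
  the first; with \<open>Alt\<^sub>8\<close> acting from the right, \<open>g(1)\<close> is the image of 1 under the inverse
  of \<open>g\<close>, and taking the image under \<open>g\<close> instead would violate the cocycle identity.\<close>

definition optimism_map ::
  "((point \<Rightarrow> point) set \<Rightarrow> nat \<Rightarrow> nat) \<Rightarrow> ((V \<Rightarrow> V) set \<Rightarrow> nat set set)
     \<Rightarrow> ((point \<Rightarrow> point) \<Rightarrow> V \<Rightarrow> V) \<Rightarrow> bool" where
  "optimism_map \<phi> \<psi> f \<longleftrightarrow>
     f \<in> carrier AGL42 \<rightarrow> D \<and>
     (\<forall>x\<in>carrier AGL42. \<forall>y\<in>carrier AGL42.
        D1 #>\<^bsub>orth_group\<^esub> f (x \<otimes>\<^bsub>AGL42\<^esub> y)
        = (D1 #>\<^bsub>orth_group\<^esub> f x) \<otimes>\<^bsub>D_mod_D1\<^esub>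
          (D1 #>\<^bsub>orth_group\<^esub>
             (perm_map x \<otimes>\<^bsub>orth_group\<^esub> f y \<otimes>\<^bsub>orth_group\<^esub> inv\<^bsub>orth_group\<^esub> (perm_map x)))) \<and>
     (\<forall>g\<in>carrier AGL42.
        \<psi> (D1 #>\<^bsub>orth_group\<^esub> f g) = even_class (sym_diff {1} {alt_act \<phi> g 1}))"

definition OG :: "((point \<Rightarrow> point) \<Rightarrow> V \<Rightarrow> V) \<Rightarrow> (V \<Rightarrow> V) set" where
  "OG f = {d \<otimes>\<^bsub>orth_group\<^esub> f x \<otimes>\<^bsub>orth_group\<^esub> perm_map x | d x. d \<in> D1 \<and> x \<in> carrier AGL42}"

definition OC :: "((point \<Rightarrow> point) \<Rightarrow> V \<Rightarrow> V) \<Rightarrow> V set" where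
  "OC f = (\<lambda>g. g x0) ` OG f"

definition OG_group :: "((point \<Rightarrow> point) \<Rightarrow> V \<Rightarrow> V) \<Rightarrow> (V \<Rightarrow> V) monoid" where
  "OG_group f = orth_group\<lparr>carrier := OG f\<rparr>"

definition O2_OG :: "((point \<Rightarrow> point) \<Rightarrow> V \<Rightarrow> V) \<Rightarrow> (V \<Rightarrow> V) set" where
  "O2_OG f = p_core 2 (OG_group f)"

end

theory Submission
  imports Defs "HOL-Algebra.Group_Action"
begin

text \<open>
  A word \<open>A \<in> RM(2,4)\<close> has an alternating form, given by the second derivative of its indicator
  function, which is 0 exactly on \<open>RM(1,4)\<close>. So \<open>D/D\<^sub>1\<close> is the space of alternating forms on
  the points, and the 28 classes of the pairs \<open>{i, j}\<close> are nondegenerate forms. Hence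
  \<open>\<O>\<C> = {eps B x0 | B \<in> NR}\<close>, where \<open>NR\<close> is the union of eight cosets of \<open>RM(1,4)\<close> that
  form a Kerdock set (\<open>NR\<close> is the Nordstrom-Robinson code), and its characters have strength 4.
  It follows that a vector \<open>u\<close> with \<open>u \<bullet> x = \<plusminus>1\<close> for all \<open>x \<in> \<O>\<C>\<close> has a single nonzero
  coordinate, so an orthogonal stabilizer of \<open>\<O>\<C>\<close> that fixes \<open>x0\<close>, which may be assumed as
  \<open>\<O>\<G>\<close> is transitive, is a permutation of the coordinates preserving \<open>NR\<close>. It then preserves
  the kernel \<open>RM(1,4)\<close> of the nonlinear code \<open>NR\<close>, which makes it affine, and the translations of
  \<open>NR\<close> by elements of \<open>RM(2,4)\<close> show that it lies in \<open>\<O>\<G>\<close>.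

  The kernel of the linear part \<open>\<O>\<G> \<rightarrow> GL(4,2)\<close> is \<open>D\<^sub>1T\<close>, which is extraspecial.
  It contains each normal 2-subgroup, because the image of such a subgroup in \<open>GL(4,2)\<close> fixes one
  of the 15 nonzero vectors and therefore all of them.
\<close>

section \<open>Reed-Muller codes and derivatives\<close>

text \<open>The identifications \<open>\<phi>\<close> and \<open>\<psi>\<close> and the map
  \<open>f\<close> are arbitrary, so no explicit isomorphism of GL(4,2) with Alt_8 is available to
  compute with. Everything needed from them is equivariance, and it is kept in the relation
  \<open>labelled A E\<close> between words and even subsets of eight points. Labels alone do not
  tell which forms are nondegenerate. Transitivity of Alt_8 on pairs makes the 28 pair classes all
  degenerate or all nondegenerate, and the Pfaffian, a nonzero quadratic form on the alternating
  forms, excludes the first case. Strength 4 rests on a count. For four points a, a+s, a+t, a+s+t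
  the character of a word is the value of its form at (s,t). For fixed s the eight representatives
  give eight distinct functionals vanishing at s. There are only 2^3 such functionals, so all of
  them occur and their signs cancel at each t outside {0,s}. Products follow right actions, so
  \<open>g\<close> times \<open>h\<close> is \<open>h \<circ> g\<close>. This is why preimages of
  words, not images, appear under conjugation.\<close>

declare add_bit_eq_xor [simp del] mult_bit_eq_and [simp del] One_nat_def [simp del]

section \<open>Arithmetic and vectors over the field of two elements\<close>

lemma bit_add_self [simp]: "x + x = 0" for x :: bit
  by (cases x) (simp_all add: add_bit_eq_xor)

lemma bit_add_self_left [simp]: "x + (x + y) = y" for x y :: bit
  by (simp add: add.assoc [symmetric])

lemmas bit_ac = add.assoc add.commute[of _ "_ :: bit"] add.left_commute[of _ "_ :: bit"]
  bit_add_self bit_add_self_left add_0_left add_0_right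

lemma CARD_bit: "CARD(bit) = 2"
proof -
  have "(UNIV :: bit set) = {0, 1}"
    by (auto intro: bit.exhaust)
  then show ?thesis
    by (metis card_2_iff zero_neq_one)
qed

lemma card_point: "CARD(point) = 16"
  by (simp add: CARD_bit)

text \<open>Turns identities in \<open>bit\<close> into propositional ones, with sums becoming
  exclusive or; after \<open>bit_bool\<close> they are within reach of \<open>argo\<close>.\<close>

lemma Rep_bit_simps [simp]:
  "\<not> Rep_bit 0" "Rep_bit 1"
  "Rep_bit (x + y) \<longleftrightarrow> Rep_bit x \<noteq> Rep_bit y"
  "Rep_bit (x * y) \<longleftrightarrow> Rep_bit x \<and> Rep_bit y"
  by (simp_all add: Rep_bit_code plus_bit_def times_bit_def Abs_bit_inverse)

lemma bit_bool: "x = y \<longleftrightarrow> (Rep_bit x \<longleftrightarrow> Rep_bit y)" for x y :: bit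
  by (simp add: Rep_bit_inject)

lemma bit_add_eq_0_iff [simp]: "x + y = 0 \<longleftrightarrow> x = y" for x y :: bit
  by (simp add: bit_bool)

lemma bitvec_2_eq_0 [simp]: "2 = (0 :: bit ^ 'n)"
  by (simp add: vec_eq_iff)

lemma bitvec_add_self [simp]: "x + x = 0" for x :: "bit ^ 'n"
  by (simp add: vec_eq_iff)

lemma bitvec_add_self_left [simp]: "x + (x + y) = y" for x y :: "bit ^ 'n"
  by (simp add: vec_eq_iff bit_bool)

lemma bitvec_diff [simp]: "x - y = x + y" for x y :: "bit ^ 'n"
  by (simp add: vec_eq_iff)

lemma bitvec_add_eq_0_iff [simp]: "x + y = 0 \<longleftrightarrow> x = y" for x y :: "bit ^ 'n"
  by (simp add: vec_eq_iff bit_bool)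

lemma bitvec_scale: "c *s x = (if c = 1 then x else 0)" for x :: "bit ^ 'n"
  by (simp add: vec_eq_iff)

lemma bitvec_subspace_iff:
  "vec.subspace W \<longleftrightarrow> 0 \<in> W \<and> (\<forall>x\<in>W. \<forall>y\<in>W. x + y \<in> W)" for W :: "(bit ^ 'n) set"
  by (auto simp: vec.subspace_def bitvec_scale)

lemma word_nth: "word A $ x = (if x \<in> A then 1 else 0)"
  by (simp add: word_def)

lemma Rep_bit_word [simp]: "Rep_bit (word A $ x) \<longleftrightarrow> x \<in> A"
  by (simp add: word_nth)

lemma word_eq_iff [simp]: "word A = word B \<longleftrightarrow> A = B"
  by (auto simp: vec_eq_iff bit_bool)

lemma word_sym_diff: "word (sym_diff A B) = word A + word B"
  by (auto simp: vec_eq_iff bit_bool)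

lemma word_empty [simp]: "word {} = 0"
  by (simp add: vec_eq_iff word_nth)

lemma word_vimage: "word (g -` A) $ x = word A $ g x"
  by (simp add: word_nth)

text \<open>Second finite difference over the field of two elements. It vanishes identically exactly
  for functions of degree at most 1; \<open>deriv3\<close> plays the same role for degree at most
  2.\<close>

definition deriv2 :: "(point \<Rightarrow> bit) \<Rightarrow> point \<Rightarrow> point \<Rightarrow> point \<Rightarrow> bit" where
  "deriv2 q a s t = q a + q (a + s) + q (a + t) + q (a + s + t)"

definition deriv3 :: "(point \<Rightarrow> bit) \<Rightarrow> point \<Rightarrow> point \<Rightarrow> point \<Rightarrow> point \<Rightarrow> bit" where
  "deriv3 q a s t u = deriv2 q a s t + deriv2 q (a + u) s t"

lemma deriv2_add: "deriv2 (\<lambda>x. p x + q x) a s t = deriv2 p a s t + deriv2 q a s t"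
  by (simp add: deriv2_def algebra_simps)

lemma deriv3_add: "deriv3 (\<lambda>x. p x + q x) a s t u = deriv3 p a s t u + deriv3 q a s t u"
  by (simp add: deriv3_def deriv2_add algebra_simps)

text \<open>Degrees add under multiplication: two factors of degree at most 1 give degree at most 2.
  Writing each factor as additive plus constant makes all terms cancel in pairs.\<close>

lemma deriv3_mult_affine:
  assumes "\<And>a s t. deriv2 p a s t = 0" "\<And>a s t. deriv2 q a s t = 0"
  shows "deriv3 (\<lambda>x. p x * q x) a s t u = 0"
proof -
  have *: "r (x + y) = r x + r y + r 0" if "\<And>a s t. deriv2 r a s t = 0" for r x y
    using that[of 0 x y] by (simp add: deriv2_def bit_bool) argo
  note P = *[of p, OF assms(1)] and Q = *[of q, OF assms(2)]
  show ?thesis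
    unfolding deriv3_def deriv2_def P Q
    by (simp add: algebra_simps)
qed

text \<open>A hyperplane over the field of two elements has only two cosets, so its complement
  behaves like an additive parity.\<close>

lemma bitvec_hyperplane_add:
  fixes W :: "(bit ^ 'n) set"
  assumes W: "vec.subspace W" and dim: "vec.dim W + 1 = CARD('n)"
  shows "x + y \<in> W \<longleftrightarrow> (x \<in> W \<longleftrightarrow> y \<in> W)"
proof -
  have sp: "vec.span W = W"
    using W by simp
  have sum: "x + y \<in> W" if "x \<notin> W" "y \<notin> W" for x y
  proof -
    have "vec.dim (insert x W) = vec.dim W + 1"
      using that(1) sp by (metis vec.dim_insert)
    then have "vec.span (insert x W) = UNIV"
      using dim vec.dim_eq_full[of "insert x W"] by (simp add: vec.dimension_def card_cart_basis)
    then have "y \<in> vec.span (insert x W)"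
      by simp
    then obtain k where k: "y - k *s x \<in> W"
      unfolding vec.span_insert sp by blast
    then show ?thesis
      using that(2) by (auto simp: bitvec_scale add.commute split: if_splits)
  qed
  have "y \<in> W" if "x + y \<in> W" "x \<in> W" for x y
    using W that bitvec_add_self_left[of x y] unfolding bitvec_subspace_iff by metis
  moreover have "x + y \<in> W" if "x \<in> W" "y \<in> W" for x y
    using W that unfolding bitvec_subspace_iff by metis
  ultimately show ?thesis
    using sum by (metis add.commute)
qed

lemma mem_translate: "x \<in> (+) a ` W \<longleftrightarrow> x + a \<in> W" for W :: "(bit ^ 'n) set"
proof -
  have "x \<in> (+) a ` W" if "x + a \<in> W"
    using that by (intro image_eqI[of _ _ "x + a"]) (simp_all add: add.commute)
  then show ?thesis
    by (auto simp: add.commute)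
qed

lemma deriv2_hyperplane:
  assumes W: "vec.subspace W" and dim: "vec.dim W + 1 = CARD(4)"
  shows "deriv2 (\<lambda>x. word ((+) b ` W) $ x) a s t = 0"
  unfolding deriv2_def
  by (auto simp: bit_bool mem_translate bitvec_hyperplane_add[OF assms])

text \<open>Adjoin to \<open>W\<close> one vector outside it, then separately a vector outside the
  first extension. The point of this is that the indicator of a plane becomes a product of two
  affine functions.\<close>

lemma plane_eq_Int_hyperplanes:
  fixes W :: "(bit ^ 'n) set"
  assumes W: "vec.subspace W" and dim: "vec.dim W + 2 = CARD('n)"
  obtains W1 W2 where "vec.subspace W1" "vec.dim W1 + 1 = CARD('n)"
    "vec.subspace W2" "vec.dim W2 + 1 = CARD('n)" "W = W1 \<inter> W2"
proof -
  have sp: "vec.span W = W"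
    using W by simp
  obtain x where x: "x \<notin> W"
    using dim vec.dim_UNIV by (metis UNIV_eq_I add_cancel_right_right vec.dimension_def zero_neq_numeral vec_dim_card)
  define W1 where "W1 = vec.span (insert x W)"
  have d1: "vec.dim W1 = vec.dim W + 1"
    unfolding W1_def using x sp by (metis vec.dim_insert vec.dim_span)
  then obtain y where y: "y \<notin> W1"
    using dim vec.dim_UNIV by (metis UNIV_eq_I add_left_cancel nat_1_add_1 n_not_Suc_n numeral_2_eq_2 vec_dim_card Suc_eq_plus1)
  have yW: "y \<notin> W"
    using y vec.span_superset unfolding W1_def by blast
  define W2 where "W2 = vec.span (insert y W)"
  have d2: "vec.dim W2 = vec.dim W + 1"
    unfolding W2_def using yW sp by (metis vec.dim_insert vec.dim_span)
  have "z \<in> W" if z1: "z \<in> W1" and z2: "z \<in> W2" for z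
  proof -
    obtain k where k: "z - k *s x \<in> W"
      using z1 unfolding W1_def vec.span_insert sp by blast
    obtain l where l: "z - l *s y \<in> W"
      using z2 unfolding W2_def vec.span_insert sp by blast
    show ?thesis
    proof (cases "l = 1")
      case True
      then have "(z - l *s y) + z \<in> W1"
        using l z1 vec.subspace_span[of "insert x W"] vec.span_superset[of "insert x W"]
        unfolding W1_def[symmetric] bitvec_subspace_iff by blast
      then show ?thesis
        using y True by (simp add: bitvec_scale add.commute)
    next
      case False
      then show ?thesis
        using l by (simp add: bitvec_scale)
    qed
  qed
  then have "W = W1 \<inter> W2"
    using vec.span_superset[of "insert x W"] vec.span_superset[of "insert y W"]
    unfolding W1_def W2_def by blast
  moreover have "vec.subspace W1" "vec.subspace W2"
    by (simp_all add: W1_def W2_def)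
  moreover have "vec.dim W1 + 1 = CARD('n)" "vec.dim W2 + 1 = CARD('n)"
    using d1 d2 dim by linarith+
  ultimately show thesis
    by (intro that[of W1 W2])
qed

lemma deriv3_plane:
  assumes W: "vec.subspace W" and dim: "vec.dim W + 2 = CARD(4)"
  shows "deriv3 (\<lambda>x. word ((+) b ` W) $ x) a s t u = 0"
proof -
  obtain W1 W2 where W12: "vec.subspace W1" "vec.dim W1 + 1 = CARD(4)"
    "vec.subspace W2" "vec.dim W2 + 1 = CARD(4)" "W = W1 \<inter> W2"
    using plane_eq_Int_hyperplanes[OF assms] .
  have "(\<lambda>x. word ((+) b ` W) $ x) = (\<lambda>x. word ((+) b ` W1) $ x * word ((+) b ` W2) $ x)"
    by (rule ext) (auto simp: bit_bool mem_translate W12(5))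
  then show ?thesis
    using deriv3_mult_affine[OF deriv2_hyperplane[OF W12(1,2), of b] deriv2_hyperplane[OF W12(3,4), of b]]
    by simp
qed

lemma RM_induct [consumes 1, case_names zero add]:
  assumes "A \<in> RM r" "P 0"
    "\<And>S w. S \<in> affine_subspaces r \<Longrightarrow> P w \<Longrightarrow> P (word S + w)"
  shows "P (word A)"
proof -
  have "word A \<in> vec.span (word ` affine_subspaces r)"
    using assms(1) by (simp add: RM_def)
  then show ?thesis
    by (induction rule: vec.span_induct_alt) (auto simp: bitvec_scale assms(2,3))
qed

lemma RM1_deriv2: "A \<in> RM 1 \<Longrightarrow> deriv2 (\<lambda>x. word A $ x) a s t = 0"
proof (induction rule: RM_induct)
  case zero
  then show ?case by (simp add: deriv2_def)
next
  case (add S w)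
  then obtain b W where "S = (+) b ` W" "vec.subspace W" "vec.dim W + 1 = CARD(4)"
    unfolding affine_subspaces_def by blast
  then show ?case
    using deriv2_hyperplane[of W b a s t] add(2) deriv2_add[of "\<lambda>x. word S $ x" "\<lambda>x. w $ x" a s t]
    by simp
qed

lemma RM2_deriv3: "A \<in> RM 2 \<Longrightarrow> deriv3 (\<lambda>x. word A $ x) a s t u = 0"
proof (induction rule: RM_induct)
  case zero
  then show ?case by (simp add: deriv2_def deriv3_def)
next
  case (add S w)
  then obtain b W where "S = (+) b ` W" "vec.subspace W" "vec.dim W + 2 = CARD(4)"
    unfolding affine_subspaces_def by blast
  then show ?case
    using deriv3_plane[of W b a s t u] add(2) deriv3_add[of "\<lambda>x. word S $ x" "\<lambda>x. w $ x" a s t u]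
    by simp
qed

lemma RM_empty [simp]: "{} \<in> RM r"
  by (simp add: RM_def vec.span_zero)

lemma RM_sym_diff: "A \<in> RM r \<Longrightarrow> B \<in> RM r \<Longrightarrow> sym_diff A B \<in> RM r"
  by (simp add: RM_def word_sym_diff vec.span_add)

lemma affine_subspaces_subset_RM: "S \<in> affine_subspaces r \<Longrightarrow> S \<in> RM r"
  by (auto simp: RM_def intro: vec.span_base)

text \<open>Over the field of two elements additivity already implies linearity, since the only
  scalars are 0 and 1.\<close>

lemma bit_additive_expand:
  fixes l :: "bit ^ 'n \<Rightarrow> bit"
  assumes "\<And>x y. l (x + y) = l x + l y"
  shows "l x = (\<Sum>i\<in>UNIV. x $ i * l (axis i 1))"
proof -
  have l0: "l 0 = 0"
    using assms[of 0 0] by simp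
  have "l x = l (\<Sum>i\<in>UNIV. x $ i *s axis i 1)"
    by (simp add: basis_expansion)
  also have "\<dots> = (\<Sum>i\<in>UNIV. l (x $ i *s axis i 1))"
    by (rule sum_comp_morphism[of l, unfolded o_def, symmetric]) (simp_all add: l0 assms)
  also have "\<dots> = (\<Sum>i\<in>UNIV. x $ i * l (axis i 1))"
    by (intro sum.cong) (auto simp: bitvec_scale l0)
  finally show ?thesis .
qed

lemma coordinate_hyperplane: "{x :: point. x $ i = c} \<in> affine_subspaces 1"
proof -
  \<comment> \<open>This shape of the linear hyperplane matches \<open>dim_substandard_cart\<close>,
    which then yields its dimension.\<close>
  let ?W = "{x :: point. \<forall>k. k \<notin> - {i} \<longrightarrow> x $ k = 0}"
  have "vec.subspace ?W"
    by (auto simp: bitvec_subspace_iff)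
  moreover have "vec.dim ?W + 1 = CARD(4)"
    by (simp only: dim_substandard_cart) (simp add: Compl_eq_Diff_UNIV card_Diff_subset)
  moreover have "{x. x $ i = c} = (+) (c *s axis i 1) ` ?W"
    by (rule Set.set_eqI) (auto simp: mem_translate axis_def)
  ultimately show ?thesis
    unfolding affine_subspaces_def by blast
qed

lemma coordinate_plane:
  assumes "i \<noteq> j"
  shows "{x :: point. x $ i = c \<and> x $ j = d} \<in> affine_subspaces 2"
proof -
  let ?W = "{x :: point. \<forall>k. k \<notin> - {i, j} \<longrightarrow> x $ k = 0}"
  have "vec.subspace ?W"
    by (auto simp: bitvec_subspace_iff)
  moreover have "vec.dim ?W + 2 = CARD(4)"
    using assms by (simp only: dim_substandard_cart) (simp add: Compl_eq_Diff_UNIV card_Diff_subset)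
  moreover have "{x. x $ i = c \<and> x $ j = d} = (+) (c *s axis i 1 + d *s axis j 1) ` ?W"
    using assms by (intro Set.set_eqI) (auto simp: mem_translate axis_def)
  ultimately show ?thesis
    unfolding affine_subspaces_def by blast
qed

text \<open>A function with vanishing second differences is a constant plus a sum of coordinates.
  The parameter \<open>r\<close> stays open because the cases 1 and 2 are both used, the second
  giving that \<open>RM 1\<close> lies in \<open>RM 2\<close>.\<close>

lemma RM_of_deriv2:
  assumes "UNIV \<in> RM r" "\<And>i. {x. x $ i = 1} \<in> RM r"
    and q: "\<And>a s t. deriv2 (\<lambda>x. word A $ x) a s t = 0"
  shows "A \<in> RM r"
proof -
  let ?q = "\<lambda>x. word A $ x"
  have "?q (x + y) = ?q x + ?q y + ?q 0" for x y
    using q[of 0 x y] by (simp add: deriv2_def bit_bool) argo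
  then have add: "?q (x + y) + ?q 0 = (?q x + ?q 0) + (?q y + ?q 0)" for x y
    by (simp add: algebra_simps)
  have "word A = ?q 0 *s word UNIV + (\<Sum>i\<in>UNIV. (?q (axis i 1) + ?q 0) *s word {x. x $ i = 1})"
  proof (rule vec_eq_iff[THEN iffD2], rule allI)
    fix x
    have "?q x + ?q 0 = (\<Sum>i\<in>UNIV. x $ i * (?q (axis i 1) + ?q 0))"
      by (rule bit_additive_expand[of "\<lambda>x. ?q x + ?q 0", OF add])
    then have "?q x = ?q 0 + (\<Sum>i\<in>UNIV. x $ i * (?q (axis i 1) + ?q 0))"
      by (simp add: bit_bool) argo
    moreover have "x $ i * b = b * word {x. x $ i = 1} $ x" for i b
      by (auto simp: bit_bool)
    ultimately show "word A $ x = (?q 0 *s word UNIV + (\<Sum>i\<in>UNIV. (?q (axis i 1) + ?q 0) *s word {x. x $ i = 1})) $ x"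
      by (simp add: word_nth[of UNIV] distrib_right)
  qed
  also have "\<dots> \<in> vec.span (word ` affine_subspaces r)"
    using assms(1,2) unfolding RM_def
    by (intro vec.span_add vec.span_scale vec.span_sum) simp_all
  finally show ?thesis
    by (simp add: RM_def)
qed

text \<open>For \<open>r = 2\<close> a hyperplane is the disjoint union of two parallel planes, and
  in both cases the whole space is the disjoint union of two parallel hyperplanes.\<close>

lemma RM_UNIV_coordinate:
  assumes "r = 1 \<or> r = 2"
  shows "UNIV \<in> RM r" "{x. x $ i = 1} \<in> RM r"
proof -
  have h: "{x. x $ i = c} \<in> RM r" for i c
  proof (cases "r = 1")
    case True
    then show ?thesis
      using coordinate_hyperplane affine_subspaces_subset_RM by blast
  next
    case False
    obtain j :: 4 where j: "j \<noteq> i"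
      by (metis zero_neq_one)
    have "{x :: point. x $ i = c} = sym_diff {x. x $ i = c \<and> x $ j = 0} {x. x $ i = c \<and> x $ j = 1}"
      by auto
    moreover have "{x :: point. x $ i = c \<and> x $ j = d} \<in> RM r" for d
      using False assms j coordinate_plane[of i j c d] affine_subspaces_subset_RM by blast
    ultimately show ?thesis
      using RM_sym_diff by presburger
  qed
  then show "{x. x $ i = 1} \<in> RM r" .
  have "UNIV = sym_diff {x :: point. x $ i = 0} {x. x $ i = 1}"
    by auto
  then show "UNIV \<in> RM r"
    using RM_sym_diff[OF h[of i 0] h[of i 1]] by simp
qed

lemma RM1_iff: "A \<in> RM 1 \<longleftrightarrow> (\<forall>a s t. deriv2 (\<lambda>x. word A $ x) a s t = 0)"
  using RM1_deriv2 RM_of_deriv2[of 1 A] RM_UNIV_coordinate[of 1] by blast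

text \<open>The polarization of the indicator function of \<open>A\<close>, taken at base point 0;
  for words of degree at most 2 the base point is immaterial
  (\<open>deriv2_eq_form\<close>).\<close>

definition form :: "point set \<Rightarrow> point \<Rightarrow> point \<Rightarrow> bit" where
  "form A s t = deriv2 (\<lambda>x. word A $ x) 0 s t"

lemma form_sym_diff: "form (sym_diff A B) s t = form A s t + form B s t"
  by (simp add: form_def word_sym_diff deriv2_add)

lemma form_commute: "form A s t = form A t s"
  by (simp add: form_def deriv2_def algebra_simps)

lemma form_self [simp]: "form A s s = 0"
  by (simp add: form_def deriv2_def algebra_simps)

lemma form_zero [simp]: "form A 0 s = 0" "form A s 0 = 0"
  by (simp_all add: form_def deriv2_def algebra_simps)

text \<open>The condition is on derivatives instead of membership in \<open>RM 2\<close>: it passes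
  through affine substitutions, and in \<open>RM2_of_deriv3\<close> it is all that is known.\<close>

locale quadratic_word =
  fixes A :: "point set"
  assumes deriv3: "deriv3 (\<lambda>x. word A $ x) a s t u = 0"
begin

lemma deriv2_eq_form: "deriv2 (\<lambda>x. word A $ x) a s t = form A s t"
  using deriv3[of 0 s t a] by (simp add: deriv3_def form_def bit_bool)

text \<open>Differences telescope along 0, s, s + u. The second piece has base point s, which may be
  moved to 0.\<close>

lemma form_add_left: "form A (s + u) t = form A s t + form A u t"
proof -
  have "form A (s + u) t = deriv2 (\<lambda>x. word A $ x) 0 s t + deriv2 (\<lambda>x. word A $ x) s u t"
    by (simp add: form_def deriv2_def algebra_simps)
  then show ?thesis
    by (simp add: deriv2_eq_form)
qed

lemma form_add_right: "form A t (s + u) = form A t s + form A t u"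
  using form_add_left by (simp add: form_commute[of A t])

lemma form_expand: "form A s t = (\<Sum>i\<in>UNIV. \<Sum>j\<in>UNIV. s $ i * (t $ j * form A (axis i 1) (axis j 1)))"
proof -
  have "form A s t = (\<Sum>i\<in>UNIV. s $ i * form A (axis i 1) t)"
    by (rule bit_additive_expand) (rule form_add_left)
  also have "\<dots> = (\<Sum>i\<in>UNIV. s $ i * (\<Sum>j\<in>UNIV. t $ j * form A (axis i 1) (axis j 1)))"
    by (intro sum.cong refl arg_cong2[where f = "(*)"] bit_additive_expand form_add_right)
  finally show ?thesis
    by (simp add: sum_distrib_left)
qed

end

lemma RM2_quadratic: "A \<in> RM 2 \<Longrightarrow> quadratic_word A"
  by (simp add: quadratic_word_def RM2_deriv3)

lemma deriv2_sum:
  "deriv2 (\<lambda>x. \<Sum>p\<in>P. b p * q p x) a s t = (\<Sum>p\<in>P. b p * deriv2 (q p) a s t)"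
  by (simp add: deriv2_def sum.distrib distrib_left)

lemma form_coordinate_plane:
  assumes "k \<noteq> l" "i \<noteq> j"
  shows "form {x. x $ k = 1 \<and> x $ l = 1} (axis i 1) (axis j 1) =
    (if {i, j} = {k, l} then 1 else 0)"
  using assms by (auto simp: form_def deriv2_def word_nth axis_def doubleton_eq_iff)

text \<open>Subtracting a combination of products of two coordinates with the same form leaves a
  word whose form is 0, hence one of degree at most 1.\<close>

lemma RM2_of_deriv3:
  assumes "quadratic_word A"
  shows "A \<in> RM 2"
proof -
  interpret quadratic_word A by fact
  let ?P = "{p. fst p < (snd p :: 4)}"
  let ?b = "\<lambda>p. form A (axis (fst p) 1) (axis (snd p) 1)"
  let ?S = "\<lambda>p. {x :: point. x $ fst p = 1 \<and> x $ snd p = 1}"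
  \<comment> \<open>The plane \<open>?S p\<close> is the monomial in two coordinates; the strict
    order lists each unordered pair of indices once.\<close>
  define w where "w = (\<Sum>p\<in>?P. ?b p *s word (?S p))"
  define B where "B = {x. w $ x = 1}"
  have wB: "w = word B"
    by (simp add: vec_eq_iff B_def word_nth)
  have "?S p \<in> RM 2" if "p \<in> ?P" for p
    using that coordinate_plane[of "fst p" "snd p"] affine_subspaces_subset_RM by auto
  then have "w \<in> vec.span (word ` affine_subspaces 2)"
    unfolding w_def RM_def by (intro vec.span_sum vec.span_scale) blast
  then have B: "B \<in> RM 2"
    by (simp add: RM_def wB)
  define C where "C = sym_diff A B"
  interpret B: quadratic_word B
    using B by (rule RM2_quadratic)
  interpret C: quadratic_word C
    using deriv3 B.deriv3 by unfold_locales (simp add: C_def word_sym_diff deriv3_add)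
  have fB: "form B (axis i 1) (axis j 1) = form A (axis i 1) (axis j 1)" if "i < j" for i j
  proof -
    have "(\<lambda>x. word B $ x) = (\<lambda>x. \<Sum>p\<in>?P. ?b p * word (?S p) $ x)"
      by (simp add: wB[symmetric] w_def)
    then have "form B s t = (\<Sum>p\<in>?P. ?b p * form (?S p) s t)" for s t
      unfolding form_def[of B] form_def[of "?S _"] by (simp only: deriv2_sum)
    also have "(\<Sum>p\<in>?P. ?b p * form (?S p) (axis i 1) (axis j 1)) = (\<Sum>p\<in>?P. if p = (i, j) then ?b p else 0)"
      using that by (intro sum.cong) (auto simp: form_coordinate_plane doubleton_eq_iff)
    also have "\<dots> = form A (axis i 1) (axis j 1)"
      using that by simp
    finally show ?thesis .
  qed
  have "form B (axis i 1) (axis j 1) = form A (axis i 1) (axis j 1)" for i j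
    using fB[of i j] fB[of j i] form_commute by (cases i j rule: linorder_cases) auto
  then have "form C s t = 0" for s t
    by (subst C.form_expand) (simp add: C_def form_sym_diff)
  then have "C \<in> RM 2"
    using RM_of_deriv2[of 2 C] RM_UNIV_coordinate[of 2] by (simp add: C.deriv2_eq_form)
  then have "sym_diff C B \<in> RM 2"
    using B by (rule RM_sym_diff)
  moreover have "sym_diff C B = A"
    by (auto simp: C_def)
  ultimately show ?thesis
    by simp
qed

lemma RM2_iff: "A \<in> RM 2 \<longleftrightarrow> quadratic_word A"
  using RM2_of_deriv3 RM2_quadratic by blast

lemma RM1_subset_RM2: "RM 1 \<subseteq> RM 2"
  using RM_of_deriv2[of 2] RM_UNIV_coordinate[of 2] RM1_deriv2 by blast

lemma RM1_iff_form: "A \<in> RM 2 \<Longrightarrow> A \<in> RM 1 \<longleftrightarrow> (\<forall>s t. form A s t = 0)"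
  unfolding RM1_iff using quadratic_word.deriv2_eq_form[OF RM2_quadratic] by simp

section \<open>Affine maps and alternating forms\<close>

lemmas bitvec_ac = add.assoc add.commute[of _ "_ :: bit ^ _"] add.left_commute[of _ "_ :: bit ^ _"]
  bitvec_add_self bitvec_add_self_left add_0_left add_0_right

text \<open>Replaces matrices by one identity: \<open>x \<mapsto> g x + g 0\<close> is additive,
  hence linear, because minus is plus.\<close>

lemma AGL42_iff:
  "g \<in> carrier AGL42 \<longleftrightarrow> bij g \<and> (\<forall>x y. g (x + y) = g x + g y + g 0)"
proof (intro iffI conjI)
  assume g: "g \<in> carrier AGL42"
  then show "bij g"
    by (simp add: AGL42_def)
  obtain M :: "bit^4^4" and b where "\<And>x. g x = x v* M + b"
    using g by (auto simp: AGL42_def)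
  then show "\<forall>x y. g (x + y) = g x + g y + g 0"
    by (simp only: vector_matrix_left_distrib vector_matrix_mult_0 bitvec_ac simp_thms)
next
  assume g: "bij g \<and> (\<forall>x y. g (x + y) = g x + g y + g 0)"
  define M :: "bit^4^4" where "M = (\<chi> i. g (axis i 1) + g 0)"
  have "g x = x v* M + g 0" for x
  proof (rule vec_eq_iff[THEN iffD2], rule allI)
    fix j
    have "(g (x + y) + g 0) $ j = (g x + g 0) $ j + (g y + g 0) $ j" for x y
      using g by (simp add: ac_simps flip: vector_add_component)
    then have "(g x + g 0) $ j = (\<Sum>i\<in>UNIV. x $ i * (g (axis i 1) + g 0) $ j)"
      by (rule bit_additive_expand)
    then have "g x $ j = (\<Sum>i\<in>UNIV. x $ i * (g (axis i 1) + g 0) $ j) + g 0 $ j"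
      by (simp add: bit_bool) argo
    then show "g x $ j = (x v* M + g 0) $ j"
      by (simp add: vector_matrix_mult_def M_def mult.commute)
  qed
  then have "\<exists>(M :: bit^4^4) b. \<forall>x. g x = x v* M + b"
    by blast
  then show "g \<in> carrier AGL42"
    using g by (simp add: AGL42_def)
qed

lemma AGL42_bij: "g \<in> carrier AGL42 \<Longrightarrow> bij g"
  by (simp add: AGL42_iff)

lemma AGL42_add: "g \<in> carrier AGL42 \<Longrightarrow> g (x + y) = g x + g y + g 0"
  by (simp add: AGL42_iff)

lemma AGL42_id [simp]: "id \<in> carrier AGL42"
  by (simp add: AGL42_iff)

lemma AGL42_comp: "g \<in> carrier AGL42 \<Longrightarrow> h \<in> carrier AGL42 \<Longrightarrow> h \<circ> g \<in> carrier AGL42"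
  by (auto simp: AGL42_iff bij_comp)

lemma AGL42_inv: 
  assumes "g \<in> carrier AGL42"
  shows "Hilbert_Choice.inv g \<in> carrier AGL42"
proof -
  let ?h = "Hilbert_Choice.inv g"
  have b: "bij g"
    using assms by (rule AGL42_bij)
  then have gh: "g (?h x) = x" for x
    by (simp add: bij_is_surj surj_f_inv_f)
  have "?h (x + y) = ?h x + ?h y + ?h 0" for x y
  proof -
    have "g (?h x + ?h y + ?h 0) = x + y"
      by (simp add: AGL42_add[OF assms] gh)
    then show ?thesis
      using b by (simp add: inv_f_eq bij_is_inj)
  qed
  then show ?thesis
    using b by (simp add: AGL42_iff bij_imp_bij_inv)
qed

lemma AGL42_mult: "g \<otimes>\<^bsub>AGL42\<^esub> h = h \<circ> g"
  by (simp add: AGL42_def)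

lemma AGL42_one: "\<one>\<^bsub>AGL42\<^esub> = id"
  by (simp add: AGL42_def)

lemma AGL42_group: "group AGL42"
proof (rule groupI)
  fix g assume g: "g \<in> carrier AGL42"
  then have "g \<circ> Hilbert_Choice.inv g = id"
    by (metis AGL42_bij bij_is_surj surj_iff)
  then show "\<exists>h\<in>carrier AGL42. h \<otimes>\<^bsub>AGL42\<^esub> g = \<one>\<^bsub>AGL42\<^esub>"
    using AGL42_inv[OF g] unfolding AGL42_mult AGL42_one by blast
qed (auto simp: AGL42_mult AGL42_one AGL42_comp)

lemma translation_AGL42: "(\<lambda>x. x + a) \<in> carrier AGL42"
proof -
  have "bij (\<lambda>x :: point. x + a)"
    by (rule o_bij[of "\<lambda>x. x + a"]) (simp_all only: fun_eq_iff o_apply id_apply bitvec_ac simp_thms)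
  then show ?thesis
    by (simp only: AGL42_iff bitvec_ac simp_thms)
qed

text \<open>The equation on the right says that the linear part of \<open>g\<close> is the
  identity.\<close>

lemma translation_subgroup_iff:
  "g \<in> translation_subgroup \<longleftrightarrow> g \<in> carrier AGL42 \<and> (\<forall>x. g x + g 0 = x)"
proof
  assume "g \<in> carrier AGL42 \<and> (\<forall>x. g x + g 0 = x)"
  then have "g = (\<lambda>x. x + g 0)"
    by (auto simp: fun_eq_iff vec_eq_iff bit_bool)
  then show "g \<in> translation_subgroup"
    unfolding translation_subgroup_def by blast
next
  assume "g \<in> translation_subgroup"
  then obtain a where "g = (\<lambda>x. x + a)"
    unfolding translation_subgroup_def by blast
  then show "g \<in> carrier AGL42 \<and> (\<forall>x. g x + g 0 = x)"
    using translation_AGL42[of a] by (simp add: add.assoc)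
qed

lemma deriv2_affine:
  assumes "g \<in> carrier AGL42"
  shows "deriv2 (\<lambda>x. q (g x)) a s t = deriv2 q (g a) (g s + g 0) (g t + g 0)"
  by (simp add: deriv2_def AGL42_add[OF assms] ac_simps)

lemma deriv3_affine:
  assumes "g \<in> carrier AGL42"
  shows "deriv3 (\<lambda>x. q (g x)) a s t u = deriv3 q (g a) (g s + g 0) (g t + g 0) (g u + g 0)"
  by (simp add: deriv3_def deriv2_affine[OF assms] AGL42_add[OF assms] ac_simps)

lemma RM1_vimage: "g \<in> carrier AGL42 \<Longrightarrow> A \<in> RM 1 \<Longrightarrow> g -` A \<in> RM 1"
  unfolding RM1_iff word_vimage by (simp add: deriv2_affine)

lemma RM2_vimage: "g \<in> carrier AGL42 \<Longrightarrow> A \<in> RM 2 \<Longrightarrow> g -` A \<in> RM 2"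
  unfolding RM2_iff quadratic_word_def word_vimage by (simp add: deriv3_affine)

lemma form_vimage:
  assumes "g \<in> carrier AGL42" "A \<in> RM 2"
  shows "form (g -` A) s t = form A (g s + g 0) (g t + g 0)"
  using quadratic_word.deriv2_eq_form[OF RM2_quadratic[OF assms(2)]]
  by (simp add: form_def[of "g -` A"] word_vimage deriv2_affine[OF assms(1)])

section \<open>Degenerate forms and the Pfaffian\<close>

definition degenerate :: "point set \<Rightarrow> bool" where
  "degenerate A \<longleftrightarrow> (\<exists>s. s \<noteq> 0 \<and> (\<forall>t. form A s t = 0))"

lemma degenerate_vimage:
  assumes g: "g \<in> carrier AGL42" and A: "A \<in> RM 2" and deg: "degenerate A"
  shows "degenerate (g -` A)"
proof -
  obtain s where s: "s \<noteq> 0" "\<And>t. form A s t = 0"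
    using deg by (auto simp: degenerate_def)
  obtain s' where s': "g s' = s + g 0"
    using AGL42_bij[OF g] by (metis bij_is_surj surj_def)
  have "s' \<noteq> 0"
    using s' s(1) by (metis add_0 add_right_cancel)
  moreover have "form (g -` A) s' t = 0" for t
    using s(2) by (simp add: form_vimage[OF g A] s' add.assoc)
  ultimately show ?thesis
    unfolding degenerate_def by blast
qed

abbreviation form_entry :: "point set \<Rightarrow> 4 \<Rightarrow> 4 \<Rightarrow> bit" where
  "form_entry A i j \<equiv> form A (axis i 1) (axis j 1)"

definition pfaffian :: "point set \<Rightarrow> bit" where
  "pfaffian A = form_entry A 1 2 * form_entry A 3 4 + form_entry A 1 3 * form_entry A 2 4
     + form_entry A 1 4 * form_entry A 2 3"

text \<open>The four equations of the radical, with the symmetric entries merged so that only the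
  six occurring in \<open>pfaffian\<close> remain.\<close>

lemma form_eq_zero_iff:
  assumes "A \<in> RM 2"
  shows "(\<forall>t. form A s t = 0) \<longleftrightarrow>
    s $ 2 * form_entry A 1 2 + s $ 3 * form_entry A 1 3 + s $ 4 * form_entry A 1 4 = 0 \<and>
    s $ 1 * form_entry A 1 2 + s $ 3 * form_entry A 2 3 + s $ 4 * form_entry A 2 4 = 0 \<and>
    s $ 1 * form_entry A 1 3 + s $ 2 * form_entry A 2 3 + s $ 4 * form_entry A 3 4 = 0 \<and>
    s $ 1 * form_entry A 1 4 + s $ 2 * form_entry A 2 4 + s $ 3 * form_entry A 3 4 = 0"
    (is "_ \<longleftrightarrow> ?R")
proof -
  interpret quadratic_word A
    using assms by (rule RM2_quadratic)
  have e: "form A s t = (\<Sum>j\<in>UNIV. t $ j * form A s (axis j 1))" for t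
    by (rule bit_additive_expand) (rule form_add_right)
  have "form A s (axis j 1) = (\<Sum>i\<in>UNIV. s $ i * form_entry A i j)" for j
    by (rule bit_additive_expand) (rule form_add_left)
  moreover have "form_entry A 2 1 = form_entry A 1 2" "form_entry A 3 1 = form_entry A 1 3"
    "form_entry A 4 1 = form_entry A 1 4" "form_entry A 3 2 = form_entry A 2 3"
    "form_entry A 4 2 = form_entry A 2 4" "form_entry A 4 3 = form_entry A 3 4"
    by (rule form_commute)+
  ultimately have "?R \<longleftrightarrow> (\<forall>j. form A s (axis j 1) = 0)"
    by (simp add: forall_4 sum_4 del: bit_add_eq_0_iff)
  also have "\<dots> \<longleftrightarrow> (\<forall>t. form A s t = 0)"
    using e by (metis (no_types, lifting) mult_zero_right sum.neutral)
  finally show ?thesis ..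
qed

text \<open>The alternating matrix times its dual, in which complementary index pairs are exchanged,
  is the Pfaffian times the identity. Hence the Pfaffian kills each radical vector, and if it is 0
  the rows of the dual matrix lie in the radical.\<close>

lemma degenerate_iff_pfaffian:
  assumes "A \<in> RM 2"
  shows "degenerate A \<longleftrightarrow> pfaffian A = 0"
proof
  assume "degenerate A"
  then obtain s where s: "s \<noteq> 0" "\<forall>t. form A s t = 0"
    by (auto simp: degenerate_def)
  have "s $ 1 * pfaffian A = 0 \<and> s $ 2 * pfaffian A = 0 \<and> s $ 3 * pfaffian A = 0 \<and> s $ 4 * pfaffian A = 0"
    using s(2) unfolding form_eq_zero_iff[OF assms] pfaffian_def
    by (simp only: bit_bool Rep_bit_simps) argo
  then show "pfaffian A = 0"
    using s(1) by (auto simp: vec_eq_iff forall_4)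
next
  assume pf: "pfaffian A = 0"
  have z: "s = 0" if "\<not> degenerate A" "\<forall>t. form A s t = 0" for s
    using that by (auto simp: degenerate_def)
  define v where "v a b c d = (\<chi> i :: 4. if i = 1 then a else if i = 2 then b else if i = 3 then c else d)"
    for a b c d :: bit
  have v: "v a b c d $ 1 = a" "v a b c d $ 2 = b" "v a b c d $ 3 = c" "v a b c d $ 4 = d" for a b c d
    by (simp_all add: v_def)
  have v0: "v a b c d = 0 \<longleftrightarrow> a = 0 \<and> b = 0 \<and> c = 0 \<and> d = 0" for a b c d
    by (simp add: vec_eq_iff forall_4 v)
  show "degenerate A"
  proof (rule ccontr)
    assume nd: "\<not> degenerate A"
    \<comment> \<open>The next three vectors are rows of the dual matrix, and together they contain
      all six entries. If the radical is trivial, every entry is 0, and then the first basis vector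
      lies in the radical.\<close>
    have "v 0 (form_entry A 3 4) (form_entry A 2 4) (form_entry A 2 3) = 0"
      by (rule z[OF nd], unfold form_eq_zero_iff[OF assms] v) (use pf in \<open>simp only: pfaffian_def bit_bool Rep_bit_simps, argo\<close>)
    moreover have "v (form_entry A 3 4) 0 (form_entry A 1 4) (form_entry A 1 3) = 0"
      by (rule z[OF nd], unfold form_eq_zero_iff[OF assms] v) (use pf in \<open>simp only: pfaffian_def bit_bool Rep_bit_simps, argo\<close>)
    moreover have "v (form_entry A 2 4) (form_entry A 1 4) 0 (form_entry A 1 2) = 0"
      by (rule z[OF nd], unfold form_eq_zero_iff[OF assms] v) (use pf in \<open>simp only: pfaffian_def bit_bool Rep_bit_simps, argo\<close>)
    ultimately have "v 1 0 0 0 = 0"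
      by (intro z[OF nd]) (simp add: v0 form_eq_zero_iff[OF assms] v)
    then show False
      by (simp add: v0)
  qed
qed

text \<open>The Pfaffian is a quadratic form in the six entries; this is its associated bilinear
  form.\<close>

definition pfaffian_polar :: "point set \<Rightarrow> point set \<Rightarrow> bit" where
  "pfaffian_polar A B = pfaffian (sym_diff A B) + pfaffian A + pfaffian B"

lemma pfaffian_sym_diff: "pfaffian (sym_diff A B) = pfaffian A + pfaffian B + pfaffian_polar A B"
  by (simp add: pfaffian_polar_def algebra_simps)

lemma pfaffian_polar_sym_diff:
  "pfaffian_polar (sym_diff A B) C = pfaffian_polar A C + pfaffian_polar B C"
  unfolding pfaffian_polar_def pfaffian_def form_sym_diff by (simp add: algebra_simps)

text \<open>The bent function x1 x2 + x3 x4.\<close>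

lemma exists_pfaffian: "\<exists>A\<in>RM 2. pfaffian A = 1"
proof -
  let ?A = "{x :: point. x $ 1 = 1 \<and> x $ 2 = 1}" and ?B = "{x :: point. x $ 3 = 1 \<and> x $ 4 = 1}"
  have "sym_diff ?A ?B \<in> RM 2"
    using coordinate_plane[of 1 2 1 1] coordinate_plane[of 3 4 1 1]
    by (intro RM_sym_diff affine_subspaces_subset_RM) simp_all
  moreover have "pfaffian (sym_diff ?A ?B) = 1"
    unfolding pfaffian_def form_sym_diff by (simp add: form_coordinate_plane doubleton_eq_iff)
  ultimately show ?thesis ..
qed

section \<open>Signed permutation maps\<close>

lemma eps_nth [simp]: "eps A x $ \<omega> = (if \<omega> \<in> A then - (x $ \<omega>) else x $ \<omega>)"
  by (simp add: eps_def)

lemma perm_map_nth: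
  assumes "bij g"
  shows "perm_map g x $ g \<omega> = x $ \<omega>"
proof -
  have "perm_map g x $ g \<omega> = (\<Sum>\<nu>\<in>UNIV. if \<nu> = \<omega> then x $ \<nu> else 0)"
    unfolding perm_map_def sum_component
    by (rule sum.cong) (auto simp: axis_def dest: injD[OF bij_is_inj[OF assms]])
  then show ?thesis
    by simp
qed

lemma eps_comp: "eps A (eps B x) = eps (sym_diff A B) x"
  by (simp add: vec_eq_iff)

lemma eps_o: "eps A \<circ> eps B = eps (sym_diff A B)"
  by (rule ext) (simp add: eps_comp)

lemma eps_empty [simp]: "eps {} = id"
  by (rule ext) (simp add: vec_eq_iff)

lemma x0_nth [simp]: "x0 $ \<omega> = 1"
proof -
  have "x0 $ \<omega> = (\<Sum>\<nu>\<in>UNIV. if \<nu> = \<omega> then 1 else 0)"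
    unfolding x0_def sum_component by (rule sum.cong) (auto simp: axis_def)
  then show ?thesis
    by simp
qed

lemma eps_x0_inject [simp]: "eps A x0 = eps B x0 \<longleftrightarrow> A = B"
  by (auto simp: vec_eq_iff split: if_splits)

lemma eps_inject [simp]: "eps A = eps B \<longleftrightarrow> A = B"
  by (metis eps_x0_inject)

lemma inner_bij:
  fixes x y :: V
  assumes "bij g" "\<And>\<omega>. x' $ g \<omega> = x $ \<omega>" "\<And>\<omega>. y' $ g \<omega> = y $ \<omega>"
  shows "x' \<bullet> y' = x \<bullet> y"
proof -
  have "(\<Sum>\<omega>\<in>UNIV. x' $ g \<omega> \<bullet> y' $ g \<omega>) = (\<Sum>\<omega>\<in>UNIV. x' $ \<omega> \<bullet> y' $ \<omega>)"
    using assms(1) by (intro sum.reindex_bij_betw) simp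
  then show ?thesis
    by (simp add: inner_vec_def assms)
qed

lemma orthogonal_transformation_eps: "orthogonal_transformation (eps A)"
  unfolding orthogonal_transformation_def
  by (auto simp: inner_vec_def intro!: linearI sum.cong simp: vec_eq_iff)

lemma orthogonal_transformation_perm_map:
  assumes "bij g"
  shows "orthogonal_transformation (perm_map g)"
  unfolding orthogonal_transformation_def
proof (intro conjI allI)
  show "linear (perm_map g)"
    by (rule linearI) (simp_all add: perm_map_def scaleR_add_left sum.distrib scaleR_sum_right)
  show "perm_map g v \<bullet> perm_map g w = v \<bullet> w" for v w
    by (rule inner_bij[OF assms]) (simp_all add: perm_map_nth[OF assms])
qed

lemma perm_map_eqI:
  assumes "bij g" "\<And>\<omega>. y $ g \<omega> = x $ \<omega>"
  shows "perm_map g x = y"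
proof (rule vec_eq_iff[THEN iffD2], rule allI)
  fix \<nu>
  obtain \<omega> where "\<nu> = g \<omega>"
    using assms(1) by (metis bij_pointE)
  then show "perm_map g x $ \<nu> = y $ \<nu>"
    by (simp add: perm_map_nth assms)
qed

lemma perm_map_comp:
  assumes "bij g" "bij h"
  shows "perm_map h (perm_map g x) = perm_map (h \<circ> g) x"
  by (rule perm_map_eqI[symmetric]) (simp_all add: assms bij_comp perm_map_nth)

lemma perm_map_id [simp]: "perm_map id = id"
  by (rule ext) (auto intro!: perm_map_eqI)

lemma perm_map_x0 [simp]: "bij g \<Longrightarrow> perm_map g x0 = x0"
  by (rule perm_map_eqI) simp_all

lemma perm_map_eps:
  assumes "bij g"
  shows "perm_map g (eps A x) = eps (g ` A) (perm_map g x)"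
  using assms by (intro perm_map_eqI) (auto simp: perm_map_nth bij_def inj_image_mem_iff)

lemma orth_group_carrier: "h \<in> carrier orth_group \<longleftrightarrow> orthogonal_transformation h"
  by (simp add: orth_group_def)

lemma orth_group_mult: "g \<otimes>\<^bsub>orth_group\<^esub> h = h \<circ> g"
  by (simp add: orth_group_def)

lemma orth_group_one: "\<one>\<^bsub>orth_group\<^esub> = id"
  by (simp add: orth_group_def)

lemma orth_group_group: "group orth_group"
proof (rule groupI)
  fix h assume "h \<in> carrier orth_group"
  then have h: "orthogonal_transformation h"
    by (simp add: orth_group_carrier)
  show "\<exists>k\<in>carrier orth_group. k \<otimes>\<^bsub>orth_group\<^esub> h = \<one>\<^bsub>orth_group\<^esub>"
  proof
    show "Hilbert_Choice.inv h \<in> carrier orth_group"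
      using orthogonal_transformation_inv[OF h] by (simp add: orth_group_carrier)
    show "Hilbert_Choice.inv h \<otimes>\<^bsub>orth_group\<^esub> h = \<one>\<^bsub>orth_group\<^esub>"
      using orthogonal_transformation_surj[OF h] by (simp add: orth_group_mult orth_group_one surj_iff[symmetric])
  qed
qed (auto simp: orth_group_carrier orth_group_mult orth_group_one orthogonal_transformation_compose
       id_def o_assoc)

lemma orth_group_inv:
  assumes "orthogonal_transformation h"
  shows "inv\<^bsub>orth_group\<^esub> h = Hilbert_Choice.inv h"
  using assms orthogonal_transformation_inv[OF assms] orthogonal_transformation_surj[OF assms]
  by (intro group.inv_equality[OF orth_group_group])
    (simp_all add: orth_group_carrier orth_group_mult orth_group_one surj_iff[symmetric])

lemma eps_mult: "eps A \<otimes>\<^bsub>orth_group\<^esub> eps B = eps (sym_diff A B)"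
  by (simp add: orth_group_mult eps_o) (simp add: sup_commute)

text \<open>In right-action notation \<open>perm_map g\<close> is applied first, so a sign at
  \<open>g \<omega>\<close> is pulled back to \<open>\<omega>\<close>: the word becomes a
  preimage.\<close>

lemma conjugate_eps:
  assumes "bij g"
  shows "perm_map g \<otimes>\<^bsub>orth_group\<^esub> eps A \<otimes>\<^bsub>orth_group\<^esub> inv\<^bsub>orth_group\<^esub> (perm_map g) = eps (g -` A)"
proof -
  have g: "orthogonal_transformation (perm_map g)"
    using assms by (rule orthogonal_transformation_perm_map)
  have "eps A (perm_map g x) = perm_map g (eps (g -` A) x)" for x
    using assms by (simp add: perm_map_eps bij_is_surj surj_image_vimage_eq)
  then show ?thesis
    using orthogonal_transformation_inj[OF g]
    by (simp add: orth_group_mult orth_group_inv[OF g] fun_eq_iff)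
qed

definition eps_coset :: "point set \<Rightarrow> (V \<Rightarrow> V) set" where
  "eps_coset A = D1 #>\<^bsub>orth_group\<^esub> eps A"

lemma eps_mem_eps_coset: "eps B \<in> eps_coset A \<longleftrightarrow> sym_diff A B \<in> RM 1"
proof -
  have "B = sym_diff C A \<longleftrightarrow> C = sym_diff A B" for C
    by auto
  then show ?thesis
    by (auto simp: eps_coset_def r_coset_def D1_def eps_mult)
qed

lemma eps_coset_subset: "d \<in> eps_coset A \<Longrightarrow> \<exists>B. d = eps B"
  by (auto simp: eps_coset_def r_coset_def D1_def eps_mult)

lemma eps_coset_eq_iff: "eps_coset A = eps_coset B \<longleftrightarrow> sym_diff A B \<in> RM 1"
proof
  assume "eps_coset A = eps_coset B"
  moreover have "eps B \<in> eps_coset B"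
    by (simp add: eps_mem_eps_coset)
  ultimately show "sym_diff A B \<in> RM 1"
    by (metis eps_mem_eps_coset)
next
  assume AB: "sym_diff A B \<in> RM 1"
  have "sym_diff A C \<in> RM 1 \<longleftrightarrow> sym_diff B C \<in> RM 1" for C
  proof -
    have "sym_diff A C = sym_diff (sym_diff A B) (sym_diff B C)"
      "sym_diff B C = sym_diff (sym_diff A B) (sym_diff A C)"
      by auto
    then show ?thesis
      using RM_sym_diff[OF AB] by metis
  qed
  then show "eps_coset A = eps_coset B"
    using eps_coset_subset eps_mem_eps_coset by blast
qed

lemma D_mod_D1_carrier: "carrier D_mod_D1 = eps_coset ` RM 2"
  by (auto simp: D_mod_D1_def FactGroup_def RCOSETS_def eps_coset_def D_def r_coset_def)

lemma D_mod_D1_mult: "eps_coset A \<otimes>\<^bsub>D_mod_D1\<^esub> eps_coset B = eps_coset (sym_diff A B)"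
proof -
  have "eps_coset A \<otimes>\<^bsub>D_mod_D1\<^esub> eps_coset B = {c \<otimes>\<^bsub>orth_group\<^esub> d | c d. c \<in> eps_coset A \<and> d \<in> eps_coset B}"
    by (auto simp: D_mod_D1_def set_mult_def)
  also have "\<dots> = eps_coset (sym_diff A B)"
  proof (intro equalityI subsetI)
    fix e assume "e \<in> {c \<otimes>\<^bsub>orth_group\<^esub> d | c d. c \<in> eps_coset A \<and> d \<in> eps_coset B}"
    then obtain c d where cd: "e = c \<otimes>\<^bsub>orth_group\<^esub> d" "c \<in> eps_coset A" "d \<in> eps_coset B"
      by blast
    then obtain A' B' where "c = eps A'" "d = eps B'"
      using eps_coset_subset by metis
    with cd have e: "e = eps (sym_diff A' B')" "eps A' \<in> eps_coset A" "eps B' \<in> eps_coset B"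
      by (simp_all only: eps_mult)
    then have "sym_diff (sym_diff A A') (sym_diff B B') \<in> RM 1"
      using RM_sym_diff[of "sym_diff A A'" 1 "sym_diff B B'"] by (simp only: eps_mem_eps_coset)
    moreover have "sym_diff (sym_diff A A') (sym_diff B B') = sym_diff (sym_diff A B) (sym_diff A' B')"
      by auto
    ultimately show "e \<in> eps_coset (sym_diff A B)"
      by (simp add: e(1) eps_mem_eps_coset)
  next
    fix e assume e: "e \<in> eps_coset (sym_diff A B)"
    then obtain C where C: "e = eps C"
      using eps_coset_subset by blast
    have "sym_diff (sym_diff A B) C = sym_diff B (sym_diff A C)" "C = sym_diff A (sym_diff A C)"
      by auto
    then have "eps (sym_diff A C) \<in> eps_coset B" "e = eps A \<otimes>\<^bsub>orth_group\<^esub> eps (sym_diff A C)" "eps A \<in> eps_coset A"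
      using e unfolding C eps_mult by (auto simp: eps_mem_eps_coset)
    then show "e \<in> {c \<otimes>\<^bsub>orth_group\<^esub> d | c d. c \<in> eps_coset A \<and> d \<in> eps_coset B}"
      by blast
  qed
  finally show ?thesis .
qed

section \<open>Even subsets\<close>

abbreviation even_set :: "nat set \<Rightarrow> bool" where
  "even_set E \<equiv> E \<subseteq> {1..8} \<and> even (card E)"

lemma even_class_eq: "E \<subseteq> {1..8} \<Longrightarrow> even_class E = {E, {1..8} - E}"
  by (auto simp: even_class_def even_subsets_def r_coset_def)

lemma even_class_eq_iff:
  assumes "E \<subseteq> {1..8}" "E' \<subseteq> {1..8}"
  shows "even_class E = even_class E' \<longleftrightarrow> E' = E \<or> E' = {1..8} - E"
  using assms by (auto simp: even_class_eq doubleton_eq_iff)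

lemma even_card_sym_diff:
  assumes "finite A" "finite B"
  shows "even (card (sym_diff A B)) \<longleftrightarrow> (even (card A) \<longleftrightarrow> even (card B))"
proof -
  have "card (sym_diff A B) = card (A - B) + card (B - A)"
    using assms by (intro card_Un_disjoint) auto
  moreover have "card A = card (A - B) + card (A \<inter> B)" "card B = card (B - A) + card (A \<inter> B)"
    using assms by (auto simp: card_Diff_subset_Int Int_commute card_mono)
  ultimately show ?thesis
    by auto
qed

lemma even_set_sym_diff:
  assumes "even_set E" "even_set E'"
  shows "even_set (sym_diff E E')"
  using assms even_card_sym_diff[of E E'] finite_subset[of _ "{1..8 :: nat}"] by auto

lemma even_module_carrier: "carrier even_module = even_class ` {E. even_set E}"
  by (auto simp: even_module_def FactGroup_def RCOSETS_def even_subsets_def even_class_def)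

lemma even_module_mult:
  assumes "even_set E" "even_set E'"
  shows "even_class E \<otimes>\<^bsub>even_module\<^esub> even_class E' = even_class (sym_diff E E')"
proof -
  have "even_class E \<otimes>\<^bsub>even_module\<^esub> even_class E' = {sym_diff F F' | F F'. F \<in> even_class E \<and> F' \<in> even_class E'}"
    by (auto simp: even_module_def set_mult_def even_subsets_def)
  also have "\<dots> = {sym_diff E E', sym_diff E ({1..8} - E'), sym_diff ({1..8} - E) E', sym_diff ({1..8} - E) ({1..8} - E')}"
  proof -
    have "{h F F' | F F'. F \<in> {a, b} \<and> F' \<in> {c, d}} = {h a c, h a d, h b c, h b d}"
      for h :: "nat set \<Rightarrow> nat set \<Rightarrow> nat set" and a b c d
      by auto
    from this[of sym_diff E "{1..8} - E" E' "{1..8} - E'"] show ?thesis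
      using assms by (simp only: even_class_eq)
  qed
  also have "\<dots> = {sym_diff E E', {1..8} - sym_diff E E'}"
  proof -
    have "sym_diff E ({1..8} - E') = {1..8} - sym_diff E E'" "sym_diff ({1..8} - E) E' = {1..8} - sym_diff E E'"
      "sym_diff ({1..8} - E) ({1..8} - E') = sym_diff E E'"
      using assms by auto
    then show ?thesis
      by auto
  qed
  also have "\<dots> = even_class (sym_diff E E')"
    using even_set_sym_diff[OF assms] by (simp add: even_class_eq)
  finally show ?thesis .
qed

lemma image_even_class:
  assumes "p permutes {1..8}" "E \<subseteq> {1..8}"
  shows "(\<lambda>E. p ` E) ` even_class E = even_class (p ` E)"
proof -
  have "p ` E \<subseteq> {1..8}" "p ` ({1..8} - E) = {1..8} - p ` E"
    using assms permutes_image[OF assms(1)] permutes_inj[OF assms(1)]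
    by (auto simp: image_set_diff)
  then show ?thesis
    using assms(2) by (simp add: even_class_eq)
qed

text \<open>The pairs \<open>{1, i}\<close> generate the even subsets under symmetric
  difference.\<close>

lemma even_set_induct [consumes 1, case_names empty step]:
  assumes "even_set E" "P {}"
    "\<And>E i. even_set E \<Longrightarrow> P E \<Longrightarrow> i \<in> {1..8} \<Longrightarrow> P (sym_diff E (sym_diff {1} {i}))"
  shows "P E"
proof -
  \<comment> \<open>\<open>c\<close> repairs parity with the point 1, so even sets correspond to
    arbitrary subsets of \<open>{2..8}\<close>, over which ordinary finite induction runs.\<close>
  define c where "c F = (if even (card F) then F else insert 1 F)" for F :: "nat set"
  have ev: "even_set (c F)" if "finite F" "F \<subseteq> {2..8}" for F
    using that by (auto simp: c_def card_insert_if)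
  have P: "F \<subseteq> {2..8} \<Longrightarrow> P (c F)" if "finite F" for F
    using that
  proof (induction F rule: finite_induct)
    case empty
    then show ?case
      using assms(2) by (simp add: c_def)
  next
    case (insert i F)
    have "c (insert i F) = sym_diff (c F) (sym_diff {1} {i})"
      using insert.hyps insert.prems by (auto simp: c_def)
    then show ?case
      using assms(3)[OF ev[OF insert.hyps(1)] insert.IH, of i] insert.prems by auto
  qed
  have fin: "finite E"
    using assms(1) finite_subset by blast
  have "c (E - {1}) = E"
    using assms(1) fin by (cases "1 \<in> E") (auto simp: c_def card_Diff_singleton_if)
  moreover have "E - {1} \<subseteq> {2..8}"
    using assms(1) by (auto dest!: subsetD)
  ultimately show ?thesis
    using P[of "E - {1}"] fin by simp
qed

section \<open>The optimism group\<close>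

text \<open>Two transpositions carry one pair to the other; if the result is odd, first exchanging
  \<open>i\<close> and \<open>j\<close> corrects the parity without changing the image of the
  pair.\<close>

lemma permutes_two_transitive_even:
  assumes "i \<in> S" "j \<in> S" "k \<in> S" "l \<in> S" "i \<noteq> j" "k \<noteq> l" "finite S"
  shows "\<exists>p. p permutes S \<and> evenperm p \<and> p ` {i, j} = {k, l}"
proof -
  let ?t = "Transposition.transpose i k :: 'a \<Rightarrow> 'a"
  let ?q = "Transposition.transpose (?t j) l \<circ> ?t"
  have q: "?q permutes S"
    using assms by (intro permutes_compose permutes_swap_id) (auto simp: Transposition.transpose_def)
  have perm: "permutation ?q" "permutation (?q \<circ> Transposition.transpose i j)"
    by (simp_all add: permutation_swap_id permutation_compose)
  have im: "?q ` {i, j} = {k, l}"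
    using assms by (auto simp: Transposition.transpose_def)
  show ?thesis
  proof (cases "evenperm ?q")
    case True
    then show ?thesis
      using q im by blast
  next
    case False
    have "evenperm (?q \<circ> Transposition.transpose i j)"
      using False perm(1) assms(5) evenperm_comp[OF perm(1) permutation_swap_id, of i j] evenperm_swap[of i j] by simp
    moreover have "?q \<circ> Transposition.transpose i j permutes S"
      by (rule permutes_compose[OF permutes_swap_id[OF assms(1,2)] q])
    moreover have "(?q \<circ> Transposition.transpose i j) ` {i, j} = {k, l}"
      using im by (simp add: image_comp[symmetric] insert_commute)
    ultimately show ?thesis
      by blast
  qed
qed

locale optimism =
  fixes \<phi> :: "(point \<Rightarrow> point) set \<Rightarrow> nat \<Rightarrow> nat"
    and \<psi> :: "(V \<Rightarrow> V) set \<Rightarrow> nat set set"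
    and f :: "(point \<Rightarrow> point) \<Rightarrow> V \<Rightarrow> V"
  assumes phi: "alt_identification \<phi>"
    and psi: "module_identification \<phi> \<psi>"
    and opt: "optimism_map \<phi> \<psi> f"
begin

abbreviation act :: "(point \<Rightarrow> point) \<Rightarrow> nat \<Rightarrow> nat" where
  "act \<equiv> alt_act \<phi>"

lemma translation_subgroup_normal: "translation_subgroup \<lhd> AGL42"
proof -
  interpret A: group AGL42
    by (rule AGL42_group)
  have inv: "inv\<^bsub>AGL42\<^esub> g = Hilbert_Choice.inv g" if "g \<in> carrier AGL42" for g
    using that AGL42_inv[OF that] AGL42_bij[OF that]
    by (intro A.inv_equality) (simp_all add: AGL42_mult AGL42_one bij_is_surj surj_iff[symmetric])
  show ?thesis
  proof (rule A.normal_invI)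
    show "subgroup translation_subgroup AGL42"
    proof (rule A.subgroupI)
      show "translation_subgroup \<subseteq> carrier AGL42" "translation_subgroup \<noteq> {}"
        by (auto simp: translation_subgroup_def translation_AGL42)
    next
      fix g assume g: "g \<in> translation_subgroup"
      then obtain a where a: "g = (\<lambda>x. x + a)"
        by (auto simp: translation_subgroup_def)
      have "Hilbert_Choice.inv g = g"
        unfolding a by (rule inv_unique_comp) (simp_all only: fun_eq_iff o_apply id_apply bitvec_ac simp_thms)
      then show "inv\<^bsub>AGL42\<^esub> g \<in> translation_subgroup"
        using g inv translation_subgroup_iff by simp
    next
      fix g h assume "g \<in> translation_subgroup" "h \<in> translation_subgroup"
      then obtain a b where "g = (\<lambda>x. x + a)" "h = (\<lambda>x. x + b)"
        by (auto simp: translation_subgroup_def)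
      then have "g \<otimes>\<^bsub>AGL42\<^esub> h = (\<lambda>x. x + (a + b))"
        by (simp add: AGL42_mult fun_eq_iff add.assoc)
      then show "g \<otimes>\<^bsub>AGL42\<^esub> h \<in> translation_subgroup"
        unfolding translation_subgroup_def by blast
    qed
  next
    fix x h assume x: "x \<in> carrier AGL42" and h: "h \<in> translation_subgroup"
    obtain a where a: "h = (\<lambda>x. x + a)"
      using h by (auto simp: translation_subgroup_def)
    have xi: "Hilbert_Choice.inv x \<in> carrier AGL42"
      using x by (rule AGL42_inv)
    have "x \<otimes>\<^bsub>AGL42\<^esub> h \<otimes>\<^bsub>AGL42\<^esub> inv\<^bsub>AGL42\<^esub> x = (\<lambda>y. Hilbert_Choice.inv x (x y + a))"
      by (simp add: AGL42_mult inv[OF x] a fun_eq_iff)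
    also have "\<dots> = (\<lambda>y. y + (Hilbert_Choice.inv x a + Hilbert_Choice.inv x 0))"
      using AGL42_bij[OF x] by (simp add: AGL42_add[OF xi] bij_is_inj add.assoc)
    finally show "x \<otimes>\<^bsub>AGL42\<^esub> h \<otimes>\<^bsub>AGL42\<^esub> inv\<^bsub>AGL42\<^esub> x \<in> translation_subgroup"
      unfolding translation_subgroup_def by blast
  qed
qed

lemma phi_hom: "\<phi> \<in> hom (AGL42 Mod translation_subgroup) (alt_group 8)"
  using phi by (simp add: alt_identification_def iso_def)

lemma act_carrier:
  assumes "x \<in> carrier AGL42"
  shows "act x permutes {1..8}" "evenperm (act x)"
proof -
  have "act x \<in> carrier (alt_group 8)"
    unfolding alt_act_def using assms by (intro hom_in_carrier[OF phi_hom]) (auto simp: carrier_FactGroup)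
  then show "act x permutes {1..8}" "evenperm (act x)"
    by (simp_all add: alt_group_carrier)
qed

text \<open>The order is reversed because the product of \<open>AGL42\<close> is reversed
  composition, whereas that of \<open>alt_group\<close> is composition.\<close>

lemma act_comp:
  assumes "x \<in> carrier AGL42" "y \<in> carrier AGL42"
  shows "act (y \<circ> x) = act x \<circ> act y"
proof -
  interpret T: normal translation_subgroup AGL42
    by (rule translation_subgroup_normal)
  have "act (y \<circ> x) = \<phi> ((translation_subgroup #>\<^bsub>AGL42\<^esub> x) \<otimes>\<^bsub>AGL42 Mod translation_subgroup\<^esub>
      (translation_subgroup #>\<^bsub>AGL42\<^esub> y))"
    using assms by (simp add: alt_act_def AGL42_mult T.rcos_sum)
  also have "\<dots> = act x \<circ> act y"
    unfolding alt_act_def alt_group_mult[of 8, symmetric]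
    using assms by (intro hom_mult[OF phi_hom]) (auto simp: carrier_FactGroup)
  finally show ?thesis .
qed

lemma act_onto:
  assumes "p permutes {1..8}" "evenperm p"
  obtains x where "x \<in> carrier AGL42" "act x = p"
proof -
  have "\<phi> ` carrier (AGL42 Mod translation_subgroup) = carrier (alt_group 8)"
    using phi by (simp add: alt_identification_def iso_def bij_betw_def)
  then have "p \<in> \<phi> ` carrier (AGL42 Mod translation_subgroup)"
    using assms by (simp add: alt_group_carrier)
  then show thesis
    using that by (auto simp: carrier_FactGroup alt_act_def)
qed

lemma act_translation:
  assumes "x \<in> translation_subgroup"
  shows "act x = id"
proof -
  interpret T: normal translation_subgroup AGL42
    by (rule translation_subgroup_normal)
  have "translation_subgroup #>\<^bsub>AGL42\<^esub> x = translation_subgroup"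
    using assms T.coset_join2 T.is_subgroup T.subset by blast
  then have "act x = \<phi> \<one>\<^bsub>AGL42 Mod translation_subgroup\<^esub>"
    by (simp add: alt_act_def)
  then show ?thesis
    using hom_one[OF phi_hom T.factorgroup_is_group alt_group_is_group] by (simp add: alt_group_one)
qed

lemma act_inv:
  assumes "x \<in> carrier AGL42"
  shows "act x (act (Hilbert_Choice.inv x) i) = i" "act (Hilbert_Choice.inv x) (act x i) = i"
proof -
  have id: "act id = id"
    by (rule act_translation) (simp add: translation_subgroup_iff)
  have "Hilbert_Choice.inv x \<circ> x = id" "x \<circ> Hilbert_Choice.inv x = id"
    using AGL42_bij[OF assms] by (simp_all add: bij_is_inj bij_is_surj surj_iff[symmetric])
  then show "act x (act (Hilbert_Choice.inv x) i) = i" "act (Hilbert_Choice.inv x) (act x i) = i"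
    using act_comp[OF assms AGL42_inv[OF assms]] act_comp[OF AGL42_inv[OF assms] assms] id
    by (metis comp_apply id_apply)+
qed

text \<open>The set \<open>E\<close> is determined by \<open>A\<close> only up to complement in \<open>{1..8}\<close>.\<close>

definition labelled :: "point set \<Rightarrow> nat set \<Rightarrow> bool" where
  "labelled A E \<longleftrightarrow> A \<in> RM 2 \<and> even_set E \<and> \<psi> (eps_coset A) = even_class E"

lemma psi_hom: "\<psi> \<in> hom D_mod_D1 even_module"
  using psi by (simp add: module_identification_def iso_def)

lemma labelled_RM2: "labelled A E \<Longrightarrow> A \<in> RM 2"
  by (simp add: labelled_def)

lemma labelled_even: "labelled A E \<Longrightarrow> even_set E"
  by (simp add: labelled_def)

lemma labelled_ex:
  assumes "A \<in> RM 2"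
  shows "\<exists>E. labelled A E"
proof -
  have "\<psi> (eps_coset A) \<in> carrier even_module"
    using assms by (intro hom_in_carrier[OF psi_hom]) (auto simp: D_mod_D1_carrier)
  then show ?thesis
    using assms by (auto simp: even_module_carrier labelled_def)
qed

lemma labelled_onto:
  assumes "even_set E"
  shows "\<exists>A. labelled A E"
proof -
  have "\<psi> ` carrier D_mod_D1 = carrier even_module"
    using psi by (simp add: module_identification_def iso_def bij_betw_def)
  then have "even_class E \<in> \<psi> ` eps_coset ` RM 2"
    using assms by (simp only: D_mod_D1_carrier even_module_carrier) blast
  then obtain A where "A \<in> RM 2" "even_class E = \<psi> (eps_coset A)"
    by blast
  then show ?thesis
    using assms unfolding labelled_def by metis
qed

lemma labelled_unique:
  "labelled A E \<Longrightarrow> labelled A E' \<Longrightarrow> E' = E \<or> E' = {1..8} - E"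
  using even_class_eq_iff unfolding labelled_def by metis

lemma labelled_sym_diff:
  assumes "labelled A E" "labelled B E'"
  shows "labelled (sym_diff A B) (sym_diff E E')"
proof -
  have "\<psi> (eps_coset (sym_diff A B)) = \<psi> (eps_coset A) \<otimes>\<^bsub>even_module\<^esub> \<psi> (eps_coset B)"
    unfolding D_mod_D1_mult[symmetric] using assms
    by (intro hom_mult[OF psi_hom]) (simp_all only: D_mod_D1_carrier labelled_def, blast+)
  also have "\<dots> = even_class (sym_diff E E')"
    using assms by (simp only: labelled_def even_module_mult)
  finally show ?thesis
    using assms RM_sym_diff even_set_sym_diff unfolding labelled_def by presburger
qed

lemma labelled_inject:
  assumes "labelled A E" "labelled B E"
  shows "sym_diff A B \<in> RM 1"
proof -
  have "inj_on \<psi> (eps_coset ` RM 2)"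
    using psi by (simp add: module_identification_def iso_def bij_betw_def D_mod_D1_carrier)
  moreover have "\<psi> (eps_coset A) = \<psi> (eps_coset B)"
    using assms by (simp add: labelled_def)
  ultimately have "eps_coset A = eps_coset B"
    using assms by (metis imageI inj_onD labelled_RM2)
  then show ?thesis
    by (simp add: eps_coset_eq_iff)
qed

text \<open>Adding the empty word to itself shows that it carries the empty label, whatever label
  was chosen for it; injectivity of \<open>\<psi>\<close> on cosets then gives the rest.\<close>

lemma labelled_empty_iff: "labelled A {} \<longleftrightarrow> A \<in> RM 1"
proof -
  obtain E where E: "labelled {} E"
    using labelled_ex RM_empty by blast
  have e: "labelled {} {}"
    using labelled_sym_diff[OF E E] by simp
  show ?thesis
  proof
    assume "labelled A {}"
    then show "A \<in> RM 1"
      using labelled_inject[OF _ e] by force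
  next
    assume A: "A \<in> RM 1"
    then have "eps_coset A = eps_coset {}"
      unfolding eps_coset_eq_iff by simp
    then show "labelled A {}"
      using A RM1_subset_RM2 e by (auto simp: labelled_def)
  qed
qed

lemma labelled_vimage:
  assumes x: "x \<in> carrier AGL42" and A: "labelled A E"
  shows "labelled (x -` A) (act x ` E)"
proof -
  have "\<psi> (eps_coset (x -` A)) = (\<lambda>E. act x ` E) ` \<psi> (eps_coset A)"
    using psi x A unfolding module_identification_def eps_coset_def
    by (auto simp: conjugate_eps[OF AGL42_bij[OF x], symmetric] labelled_def D_def)
  also have "\<dots> = even_class (act x ` E)"
    using A image_even_class[OF act_carrier(1)[OF x]] by (simp add: labelled_def)
  finally have "\<psi> (eps_coset (x -` A)) = even_class (act x ` E)" .
  moreover have "card (act x ` E) = card E"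
    using permutes_inj[OF act_carrier(1)[OF x]] by (intro card_image) (auto intro: inj_on_subset)
  moreover have "act x ` E \<subseteq> {1..8}"
    using A permutes_image[OF act_carrier(1)[OF x]] by (auto simp: labelled_def)
  ultimately show ?thesis
    using A RM2_vimage[OF x] by (simp add: labelled_def)
qed

text \<open>Multiplication by \<open>D1\<close> lets the factor \<open>f x\<close> run through all
  words with its label, so the representatives picked by \<open>f\<close> drop out and only labels
  remain.\<close>

lemma OG_iff:
  "h \<in> OG f \<longleftrightarrow> (\<exists>A x. x \<in> carrier AGL42 \<and> labelled A (sym_diff {1} {act x 1}) \<and> h = perm_map x \<circ> eps A)"
proof -
  have ev: "even_set (sym_diff {1} {act x 1})" if "x \<in> carrier AGL42" for x
    using permutes_in_image[OF act_carrier(1)[OF that], of 1] even_card_sym_diff[of "{1}" "{act x 1}"] by auto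
  have f: "\<exists>F. f x = eps F \<and> labelled F (sym_diff {1} {act x 1})" if x: "x \<in> carrier AGL42" for x
  proof -
    have "f x \<in> D"
      using opt x by (auto simp: optimism_map_def)
    then obtain F where F: "F \<in> RM 2" "f x = eps F"
      by (auto simp: D_def)
    have "\<psi> (eps_coset F) = even_class (sym_diff {1} {act x 1})"
      using opt x F(2) unfolding optimism_map_def eps_coset_def by metis
    then show ?thesis
      using F ev[OF x] unfolding labelled_def by blast
  qed
  have "h \<in> OG f \<longleftrightarrow> (\<exists>B x. B \<in> RM 1 \<and> x \<in> carrier AGL42 \<and> h = perm_map x \<circ> (f x \<circ> eps B))"
    by (auto simp: OG_def D1_def orth_group_mult)
  also have "\<dots> \<longleftrightarrow> (\<exists>A x. x \<in> carrier AGL42 \<and> labelled A (sym_diff {1} {act x 1}) \<and> h = perm_map x \<circ> eps A)"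
  proof (intro iffI; elim exE conjE)
    fix B x assume B: "B \<in> RM 1" and x: "x \<in> carrier AGL42" and h: "h = perm_map x \<circ> (f x \<circ> eps B)"
    obtain F where F: "f x = eps F" "labelled F (sym_diff {1} {act x 1})"
      using f[OF x] by blast
    have "labelled (sym_diff F B) (sym_diff {1} {act x 1})"
      using labelled_sym_diff[OF F(2), of B "{}"] B labelled_empty_iff by simp
    then show "\<exists>A x. x \<in> carrier AGL42 \<and> labelled A (sym_diff {1} {act x 1}) \<and> h = perm_map x \<circ> eps A"
      using x h unfolding F(1) eps_o by blast
  next
    fix A x assume x: "x \<in> carrier AGL42" and A: "labelled A (sym_diff {1} {act x 1})" and h: "h = perm_map x \<circ> eps A"
    obtain F where F: "f x = eps F" "labelled F (sym_diff {1} {act x 1})"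
      using f[OF x] by blast
    have "eps A = f x \<circ> eps (sym_diff F A)"
      unfolding F(1) eps_o by (rule arg_cong[of _ _ eps]) auto
    with h have "h = perm_map x \<circ> (f x \<circ> eps (sym_diff F A))"
      by (simp only:)
    then show "\<exists>B x. B \<in> RM 1 \<and> x \<in> carrier AGL42 \<and> h = perm_map x \<circ> (f x \<circ> eps B)"
      by (intro exI[of _ "sym_diff F A"] exI[of _ x] conjI labelled_inject[OF F(2) A] x)
  qed
  finally show ?thesis .
qed

end

section \<open>The Kerdock set\<close>

definition sgn_bit :: "bit \<Rightarrow> real" where
  "sgn_bit b = (if b = 1 then - 1 else 1)"

lemma sgn_bit_0 [simp]: "sgn_bit 0 = 1"
  by (simp add: sgn_bit_def)

lemma sgn_bit_add: "sgn_bit (a + b) = sgn_bit a * sgn_bit b"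
  by (cases a; cases b) (simp_all add: sgn_bit_def)

text \<open>Translation by \<open>u\<close> permutes the points and changes the sign of every
  term.\<close>

lemma sum_sgn_bit_additive:
  fixes l :: "point \<Rightarrow> bit"
  assumes l: "\<And>x y. l (x + y) = l x + l y" and u: "l u = 1"
  shows "(\<Sum>t\<in>UNIV. sgn_bit (l t)) = 0"
proof -
  have "(\<Sum>t\<in>UNIV. sgn_bit (l t)) = (\<Sum>t\<in>UNIV. sgn_bit (l (t + u)))"
    using AGL42_bij[OF translation_AGL42[of u]]
    by (intro sum.reindex_bij_betw[symmetric])
  also have "\<dots> = - (\<Sum>t\<in>UNIV. sgn_bit (l t))"
    by (simp add: l u sgn_bit_add sum_negf) (simp add: sgn_bit_def sum_negf)
  finally show ?thesis
    by simp
qed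

text \<open>Parseval's identity: \<open>S t = (\<Sum>i. sgn_bit (l i t))\<close> satisfies \<open>(\<Sum>t. (S t)\<^sup>2) = 128\<close>, and
  this is already exhausted by \<open>t = 0\<close> and \<open>t = s\<close>.\<close>

lemma sum_sgn_bit_eq_0:
  fixes l :: "nat \<Rightarrow> point \<Rightarrow> bit"
  assumes l: "\<And>i x y. i \<in> {1..8} \<Longrightarrow> l i (x + y) = l i x + l i y"
    and ls: "\<And>i. i \<in> {1..8} \<Longrightarrow> l i s = 0"
    and ne: "\<And>i j. i \<in> {1..8} \<Longrightarrow> j \<in> {1..8} \<Longrightarrow> i \<noteq> j \<Longrightarrow> \<exists>u. l i u + l j u = 1"
    and st: "s \<noteq> 0" "t \<noteq> 0" "t \<noteq> s"
  shows "(\<Sum>i\<in>{1..8}. sgn_bit (l i t)) = 0"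
proof -
  define S where "S t = (\<Sum>i\<in>{1..8}. sgn_bit (l i t))" for t
  have l0: "l i 0 = 0" if "i \<in> {1..8}" for i
    using l[OF that, of 0 0] by simp
  have "(\<Sum>t\<in>UNIV. (S t)\<^sup>2) = (\<Sum>t\<in>UNIV. \<Sum>i\<in>{1..8}. \<Sum>j\<in>{1..8}. sgn_bit (l i t + l j t))"
    by (simp add: S_def power2_eq_square sum_product sgn_bit_add)
  also have "\<dots> = (\<Sum>i\<in>{1..8}. \<Sum>j\<in>{1..8}. \<Sum>t\<in>UNIV. sgn_bit (l i t + l j t))"
    by (subst sum.swap) (intro sum.cong refl sum.swap)
  \<comment> \<open>Orthogonality of characters: distinct functionals contribute 0, and each of the
    eight diagonal terms counts the 16 points.\<close>
  also have "\<dots> = (\<Sum>i\<in>{1..8 :: nat}. \<Sum>j\<in>{1..8}. if j = i then 16 else 0)"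
  proof (intro sum.cong refl)
    fix i j :: nat assume ij: "i \<in> {1..8}" "j \<in> {1..8}"
    show "(\<Sum>t\<in>UNIV. sgn_bit (l i t + l j t)) = (if j = i then 16 else 0)"
    proof (cases "j = i")
      case True
      then show ?thesis
        using card_point by simp
    next
      case False
      then obtain u where "l i u + l j u = 1"
        using ne[OF ij] by blast
      then have "(\<Sum>t\<in>UNIV. sgn_bit (l i t + l j t)) = 0"
        using ij by (intro sum_sgn_bit_additive[where u = u]) (simp_all add: l ac_simps)
      then show ?thesis
        using False by simp
    qed
  qed
  also have "\<dots> = 128"
    by simp
  finally have total: "(\<Sum>t\<in>UNIV. (S t)\<^sup>2) = 128" .
  have "(\<Sum>t\<in>{0, s, t}. (S t)\<^sup>2) \<le> (\<Sum>t\<in>UNIV. (S t)\<^sup>2)"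
    by (intro sum_mono2) auto
  moreover have "S 0 = 8" "S s = 8"
    using l0 ls by (simp_all add: S_def)
  ultimately have "(S t)\<^sup>2 \<le> 0"
    using st total by simp
  then show ?thesis
    by (simp add: S_def)
qed

text \<open>With eight points there is room for a second, disjoint transposition that makes the
  permutation even.\<close>

lemma even_permutation_moving:
  assumes "i \<in> {1..8 :: nat}" "k \<in> {1..8}"
  shows "\<exists>p. p permutes {1..8} \<and> evenperm p \<and> p i = k"
proof (cases "i = k")
  case True
  then show ?thesis
    by (intro exI[of _ id]) (simp add: permutes_id evenperm_id)
next
  case False
  have "card ({1..8} - {i, k}) = 6"
    using assms False by (subst card_Diff_subset) auto
  then have "\<not> card ({1..8} - {i, k}) \<le> Suc 0"
    by simp
  then have "\<exists>a\<in>{1..8} - {i, k}. \<exists>b\<in>{1..8} - {i, k}. a \<noteq> b"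
    by (metis card_le_Suc0_iff_eq finite_Diff finite_atLeastAtMost)
  then obtain a b where ab: "a \<in> {1..8} - {i, k}" "b \<in> {1..8} - {i, k}" "a \<noteq> b"
    by blast
  let ?p = "Transposition.transpose i k \<circ> Transposition.transpose a b"
  have "?p permutes {1..8}"
    using assms ab by (intro permutes_compose permutes_swap_id) auto
  moreover have "evenperm ?p"
    using False ab by (simp add: evenperm_comp permutation_swap_id evenperm_swap)
  moreover have "?p i = k"
    using ab by (auto simp: Transposition.transpose_def)
  ultimately show ?thesis
    by blast
qed

lemma pfaffian_cong: "form A = form B \<Longrightarrow> pfaffian A = pfaffian B"
  by (simp add: pfaffian_def)

lemma pfaffian_polar_cong: "form A = form B \<Longrightarrow> pfaffian_polar A C = pfaffian_polar B C"
  unfolding pfaffian_polar_def pfaffian_def form_sym_diff by simp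

context optimism
begin

lemma labelled_form_eq:
  assumes "labelled A E" "labelled B E"
  shows "form A = form B"
proof (intro ext)
  fix s t
  have "sym_diff A B \<in> RM 1"
    using assms by (rule labelled_inject)
  then have "form (sym_diff A B) s t = 0"
    using RM1_iff_form RM1_subset_RM2 by blast
  then show "form A s t = form B s t"
    by (simp add: form_sym_diff)
qed

lemma labelled_empty_pfaffian: "labelled A {} \<Longrightarrow> pfaffian A = 0"
  using RM1_iff_form RM1_subset_RM2 unfolding labelled_empty_iff by (auto simp: pfaffian_def)

lemma even_set_pair: "i \<in> {1..8} \<Longrightarrow> j \<in> {1..8} \<Longrightarrow> even_set (sym_diff {i} {j})"
  using even_card_sym_diff[of "{i}" "{j}"] by auto

text \<open>An even permutation of the eight points is realised by an affine map, which preserves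
  degeneracy, and a label determines the form.\<close>

lemma degenerate_pair_imp:
  assumes "labelled A {i, j}" "labelled B {k, l}" "i \<noteq> j" "k \<noteq> l" "degenerate A"
  shows "degenerate B"
proof -
  have "{i, j} \<subseteq> {1..8}" "{k, l} \<subseteq> {1..8}"
    using assms(1,2) labelled_even by blast+
  then obtain p where p: "p permutes {1..8}" "evenperm p" "p ` {i, j} = {k, l}"
    using permutes_two_transitive_even[of i "{1..8}" j k l] assms(3,4) by auto
  obtain x where x: "x \<in> carrier AGL42" "act x = p"
    using act_onto[OF p(1,2)] .
  have "degenerate (x -` A)"
    using x(1) labelled_RM2[OF assms(1)] assms(5) by (rule degenerate_vimage)
  moreover have "labelled (x -` A) {k, l}"
    using labelled_vimage[OF x(1) assms(1)] by (simp only: x(2) p(3))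
  ultimately show ?thesis
    using labelled_form_eq[OF _ assms(2)] by (metis degenerate_def)
qed

text \<open>If one pair were degenerate, then all 28 pairs would be, and the span of the classes of the
  pairs \<open>{1, i}\<close>, which is all of \<open>D/D\<^sub>1\<close>, would be totally singular for the Pfaffian.\<close>

lemma pair_nondegenerate:
  assumes A: "labelled A {i, j}" and ij: "i \<noteq> j"
  shows "\<not> degenerate A"
proof
  assume deg: "degenerate A"
  have pf: "pfaffian B = 0" if B: "labelled B (sym_diff {k} {l})" for B k l
  proof (cases "k = l")
    case True
    then show ?thesis
      using B labelled_empty_pfaffian by simp
  next
    case False
    then have "labelled B {k, l}"
      using B by (simp add: insert_commute Un_commute insert_Diff_if)
    then have "degenerate B"
      using degenerate_pair_imp[OF A _ ij False deg] by blast
    then show ?thesis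
      using degenerate_iff_pfaffian labelled_RM2[OF B] by blast
  qed
  have "\<exists>B. labelled B (sym_diff {1} {k})" if "k \<in> {1..8}" for k
    using that by (intro labelled_onto even_set_pair) auto
  then obtain R where R: "\<And>k. k \<in> {1..8} \<Longrightarrow> labelled (R k) (sym_diff {1} {k})"
    by metis
  \<comment> \<open>The sum of the words labelled \<open>{1, k}\<close> and \<open>{1, l}\<close> is
    labelled by the pair \<open>{k, l}\<close>, or by the empty set, so all three Pfaffians in the
    polar form vanish.\<close>
  have polar: "pfaffian_polar (R k) (R l) = 0" if "k \<in> {1..8}" "l \<in> {1..8}" for k l
  proof -
    have "sym_diff (sym_diff {1} {k}) (sym_diff {1} {l}) = sym_diff {k} {l}"
      by auto
    then have "labelled (sym_diff (R k) (R l)) (sym_diff {k} {l})"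
      using labelled_sym_diff[OF R[OF that(1)] R[OF that(2)]] by (simp only:)
    then show ?thesis
      using pf[OF R[OF that(1)]] pf[OF R[OF that(2)]] pf by (simp add: pfaffian_polar_def)
  qed
  \<comment> \<open>The polar values must be carried through the induction, since adding
    \<open>R i\<close> to a word changes its Pfaffian by a polar term.\<close>
  have sing: "\<forall>B. labelled B E \<longrightarrow> pfaffian B = 0 \<and> (\<forall>l\<in>{1..8}. pfaffian_polar B (R l) = 0)"
    if "even_set E" for E
    using that
  proof (induction E rule: even_set_induct)
    case empty
    show ?case
    proof (intro allI impI conjI ballI)
      fix B l assume B: "labelled B {}" and l: "l \<in> {1..8 :: nat}"
      show "pfaffian_polar B (R l) = 0"
        using labelled_sym_diff[OF B R[OF l]] labelled_empty_pfaffian[OF B] pf R[OF l]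
        by (simp add: pfaffian_polar_def)
    qed (rule labelled_empty_pfaffian)
  next
    case (step E i)
    obtain C where C: "labelled C E"
      using labelled_onto step.hyps by blast
    show ?case
    proof (rule allI, rule impI)
      fix B assume B: "labelled B (sym_diff E (sym_diff {1} {i}))"
      have eq: "form B = form (sym_diff C (R i))"
        using labelled_form_eq[OF B labelled_sym_diff[OF C R[OF step.hyps(2)]]] .
      have "pfaffian B = 0"
        unfolding pfaffian_cong[OF eq] pfaffian_sym_diff
        using step C pf[OF R] by simp
      moreover have "pfaffian_polar B (R l) = 0" if "l \<in> {1..8}" for l
        unfolding pfaffian_polar_cong[OF eq] pfaffian_polar_sym_diff
        using step C that polar by simp
      ultimately show "pfaffian B = 0 \<and> (\<forall>l\<in>{1..8}. pfaffian_polar B (R l) = 0)"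
        by blast
    qed
  qed
  obtain B where B: "B \<in> RM 2" "pfaffian B = 1"
    using exists_pfaffian by blast
  obtain E where E: "labelled B E"
    using labelled_ex[OF B(1)] by blast
  have "\<forall>B. labelled B E \<longrightarrow> pfaffian B = 0 \<and> (\<forall>l\<in>{1..8}. pfaffian_polar B (R l) = 0)"
    by (rule sing) (rule labelled_even[OF E])
  then have "pfaffian B = 0"
    using E by metis
  then show False
    using B(2) by simp
qed

text \<open>The index \<open>i = 1\<close> has the empty label and contributes \<open>RM 1\<close>
  itself.\<close>

definition NR :: "point set set" where
  "NR = {B. \<exists>i\<in>{1..8}. labelled B (sym_diff {1} {i})}"

definition rep :: "nat \<Rightarrow> point set" where
  "rep i = (SOME B. labelled B (sym_diff {1} {i}))"

lemma labelled_rep: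
  assumes "i \<in> {1..8}"
  shows "labelled (rep i) (sym_diff {1} {i})"
proof -
  have "even_set (sym_diff {1} {i})"
    using assms by (intro even_set_pair) simp_all
  then show ?thesis
    unfolding rep_def by (rule someI_ex[OF labelled_onto])
qed

lemma labelled_rep_sym_diff:
  assumes "i \<in> {1..8}" "j \<in> {1..8}"
  shows "labelled (sym_diff (rep i) (rep j)) (sym_diff {i} {j})"
proof -
  have "sym_diff (sym_diff {1} {i}) (sym_diff {1} {j}) = sym_diff {i} {j}"
    by auto
  then show ?thesis
    using labelled_sym_diff[OF labelled_rep[OF assms(1)] labelled_rep[OF assms(2)]] by (simp only:)
qed

lemma rep_nondegenerate:
  assumes "i \<in> {1..8}" "j \<in> {1..8}" "i \<noteq> j"
  shows "\<not> degenerate (sym_diff (rep i) (rep j))"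
proof -
  have "sym_diff {i} {j} = {i, j}"
    using assms(3) by auto
  then show ?thesis
    using labelled_rep_sym_diff[OF assms(1,2)] pair_nondegenerate assms(3) by metis
qed

text \<open>For fixed \<open>s\<close> the functionals \<open>form (rep i) s\<close> vanish at
  \<open>s\<close> because the forms are alternating, and they are pairwise distinct because the
  differences of the forms are nondegenerate.\<close>

lemma sum_form_rep:
  assumes "s \<noteq> 0" "t \<noteq> 0" "t \<noteq> s"
  shows "(\<Sum>i\<in>{1..8}. sgn_bit (form (rep i) s t)) = 0"
proof (rule sum_sgn_bit_eq_0[OF _ _ _ assms])
  fix i :: nat assume "i \<in> {1..8}"
  then show "form (rep i) s (x + y) = form (rep i) s x + form (rep i) s y" for x y
    using quadratic_word.form_add_right[OF RM2_quadratic] labelled_rep labelled_RM2 by blast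
next
  fix i j :: nat assume "i \<in> {1..8}" "j \<in> {1..8}" "i \<noteq> j"
  then have "\<exists>u. form (sym_diff (rep i) (rep j)) s u \<noteq> 0"
    using rep_nondegenerate assms(1) unfolding degenerate_def by metis
  then show "\<exists>u. form (rep i) s u + form (rep j) s u = 1"
    by (simp only: form_sym_diff bit_not_zero_iff)
qed simp

lemma NR_bij: "bij_betw (\<lambda>(i, C). sym_diff (rep i) C) ({1..8} \<times> RM 1) NR"
proof (rule bij_betwI')
  fix p q :: "nat \<times> point set" assume "p \<in> {1..8} \<times> RM 1" "q \<in> {1..8} \<times> RM 1"
  then obtain i C j C' where pq: "p = (i, C)" "q = (j, C')" "i \<in> {1..8}" "j \<in> {1..8}" "C \<in> RM 1" "C' \<in> RM 1"
    by auto
  have "i = j \<and> C = C'" if eq: "sym_diff (rep i) C = sym_diff (rep j) C'"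
  proof -
    have "sym_diff (rep i) (rep j) = sym_diff C C'"
      \<comment> \<open>Cancellation of symmetric differences is carried out in the group of sign
        changes, through injectivity of \<open>eps\<close>.\<close>
      using eq by (metis (no_types, lifting) eps_inject eps_o o_assoc sup_commute Diff_cancel Un_empty_left eps_empty comp_id id_comp)
    then have "sym_diff (rep i) (rep j) \<in> RM 1"
      using RM_sym_diff pq by metis
    then have "degenerate (sym_diff (rep i) (rep j))"
      unfolding degenerate_def using RM1_iff_form RM1_subset_RM2 by (metis subsetD zero_neq_one axis_eq_0_iff)
    then have "i = j"
      using rep_nondegenerate pq by blast
    moreover have "C = C'"
      using eq \<open>i = j\<close> by auto
    ultimately show ?thesis
      by blast
  qed
  then show "((case p of (i, C) \<Rightarrow> sym_diff (rep i) C) = (case q of (i, C) \<Rightarrow> sym_diff (rep i) C)) = (p = q)"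
    unfolding pq by auto
next
  fix p :: "nat \<times> point set" assume "p \<in> {1..8} \<times> RM 1"
  then obtain i C where p: "p = (i, C)" "i \<in> {1..8}" "C \<in> RM 1"
    by auto
  then have "labelled (sym_diff (rep i) C) (sym_diff {1} {i})"
    using labelled_sym_diff[OF labelled_rep, of i C "{}"] labelled_empty_iff by simp
  then show "(case p of (i, C) \<Rightarrow> sym_diff (rep i) C) \<in> NR"
    using p by (auto simp: NR_def)
next
  fix B assume "B \<in> NR"
  then obtain i where i: "i \<in> {1..8}" "labelled B (sym_diff {1} {i})"
    by (auto simp: NR_def)
  have "sym_diff (rep i) B \<in> RM 1"
    using labelled_inject[OF labelled_rep[OF i(1)] i(2)] .
  moreover have "B = sym_diff (rep i) (sym_diff (rep i) B)"
    by auto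
  ultimately show "\<exists>p\<in>{1..8} \<times> RM 1. B = (case p of (i, C) \<Rightarrow> sym_diff (rep i) C)"
    using i(1) by (intro bexI[of _ "(i, sym_diff (rep i) B)"]) auto
qed

lemma RM1_subset_NR: "RM 1 \<subseteq> NR"
  using labelled_empty_iff by (force simp: NR_def)

lemma NR_sym_diff_RM1: "B \<in> NR \<Longrightarrow> C \<in> RM 1 \<Longrightarrow> sym_diff B C \<in> NR"
  using labelled_sym_diff[of B _ C "{}"] labelled_empty_iff[of C] by (auto simp: NR_def)

text \<open>Here the nonlinearity of the code enters: adding a word with label \<open>{1, i}\<close>
  to one with label \<open>{1, j}\<close> gives the label \<open>{i, j}\<close>, which avoids 1 and
  is not a label of a word in \<open>NR\<close>.\<close>

lemma RM1_eq_kernel: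
  assumes "\<And>B. B \<in> NR \<Longrightarrow> sym_diff C B \<in> NR"
  shows "C \<in> RM 1"
proof -
  have "sym_diff C {} \<in> NR"
    using assms RM1_subset_NR RM_empty by blast
  then obtain j where j: "j \<in> {1..8}" "labelled C (sym_diff {1} {j})"
    by (auto simp: NR_def)
  show ?thesis
  proof (cases "j = 1")
    case True
    then show ?thesis
      using j labelled_empty_iff by simp
  next
    case False
    define i :: nat where "i = (if j = 2 then 3 else 2)"
    have i: "i \<in> {1..8}" "i \<noteq> 1" "i \<noteq> j"
      by (auto simp: i_def)
    have "rep i \<in> NR"
      using labelled_rep[OF i(1)] i(1) unfolding NR_def by blast
    then have "sym_diff C (rep i) \<in> NR"
      by (rule assms)
    then obtain k where k: "k \<in> {1..8}" "labelled (sym_diff C (rep i)) (sym_diff {1} {k})"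
      unfolding NR_def by blast
    have "labelled (sym_diff C (rep i)) (sym_diff (sym_diff {1} {j}) (sym_diff {1} {i}))"
      by (rule labelled_sym_diff[OF j(2) labelled_rep[OF i(1)]])
    moreover have "sym_diff (sym_diff {1} {j}) (sym_diff {1} {i}) = {i, j}"
      using i False by auto
    ultimately have "labelled (sym_diff C (rep i)) {i, j}"
      by (simp only:)
    from labelled_unique[OF this k(2)] show ?thesis
    proof
      assume "sym_diff {1} {k} = {i, j}"
      then show ?thesis
        using i False by (cases "k = 1") auto
    next
      \<comment> \<open>Labels are defined only up to complement, so this alternative has to be
        excluded by comparing at most 2 elements with 6.\<close>
      assume eq: "sym_diff {1} {k} = {1..8} - {i, j}"
      have "card (sym_diff {1} {k}) \<le> card {1, k}"
        by (intro card_mono) auto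
      also have "\<dots> \<le> 2"
        by (simp add: card_insert_if)
      finally have "card ({1..8} - {i, j}) \<le> 2"
        by (simp only: eq)
      moreover have "card ({1..8} - {i, j}) = 6"
        using i j(1) by (subst card_Diff_subset) auto
      ultimately show ?thesis
        by simp
    qed
  qed
qed

end

section \<open>The group acting on the code, and the character sums of the code\<close>

lemma eps_x0_sgn: "eps B x0 $ \<omega> = sgn_bit (word B $ \<omega>)"
  by (simp add: sgn_bit_def word_nth)

lemma sum_sum_delta:
  fixes X :: "'a :: finite \<Rightarrow> 'b :: finite \<Rightarrow> real"
  shows "(\<Sum>c\<in>UNIV. \<Sum>d\<in>UNIV. if c = a \<and> d = b then X c d else 0) = X a b"
proof -
  have "(\<Sum>c\<in>UNIV. \<Sum>d\<in>UNIV. if c = a \<and> d = b then X c d else 0)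
      = (\<Sum>c\<in>UNIV. if c = a then \<Sum>d\<in>UNIV. if d = b then X c d else 0 else 0)"
    by (intro sum.cong) auto
  then show ?thesis
    by simp
qed

lemma monomial_comp:
  assumes "bij x" "bij y"
  shows "(perm_map y \<circ> eps B) \<circ> (perm_map x \<circ> eps A) = perm_map (y \<circ> x) \<circ> eps (sym_diff (x -` B) A)"
proof
  fix v
  have "eps B (perm_map x w) = perm_map x (eps (x -` B) w)" for w
    using assms(1) by (simp add: perm_map_eps bij_is_surj surj_image_vimage_eq)
  then show "((perm_map y \<circ> eps B) \<circ> (perm_map x \<circ> eps A)) v = (perm_map (y \<circ> x) \<circ> eps (sym_diff (x -` B) A)) v"
    by (simp add: perm_map_comp[OF assms] eps_comp)
qed

context optimism
begin

lemma image_pair_act: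
  assumes "x \<in> carrier AGL42"
  shows "act x ` sym_diff {i} {j} = sym_diff {act x i} {act x j}"
  using permutes_inj[OF act_carrier(1)[OF assms]] by (auto simp: inj_eq)

lemma OG_E:
  assumes "h \<in> OG f"
  obtains A x where "x \<in> carrier AGL42" "bij x" "labelled A (sym_diff {1} {act x 1})" "h = perm_map x \<circ> eps A"
  using assms AGL42_bij unfolding OG_iff by blast

lemma OG_I:
  "x \<in> carrier AGL42 \<Longrightarrow> labelled A (sym_diff {1} {act x 1}) \<Longrightarrow> perm_map x \<circ> eps A \<in> OG f"
  unfolding OG_iff by blast

lemma OG_orthogonal: "h \<in> OG f \<Longrightarrow> orthogonal_transformation h"
  by (elim OG_E) (simp add: orthogonal_transformation_compose orthogonal_transformation_eps
      orthogonal_transformation_perm_map)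

lemma OG_id: "id \<in> OG f"
proof -
  have "act id = id"
    by (rule act_translation) (simp add: translation_subgroup_iff)
  then show ?thesis
    using OG_I[of id "{}"] labelled_empty_iff by simp
qed

text \<open>The labels telescope through the common point \<open>act x 1\<close>; this is the
  cocycle identity for \<open>{1} + {g(1)}\<close>.\<close>

lemma OG_comp:
  assumes "g \<in> OG f" "h \<in> OG f"
  shows "h \<circ> g \<in> OG f"
proof -
  obtain A x where g: "x \<in> carrier AGL42" "bij x" "labelled A (sym_diff {1} {act x 1})" "g = perm_map x \<circ> eps A"
    using assms(1) by (rule OG_E)
  obtain B y where h: "y \<in> carrier AGL42" "bij y" "labelled B (sym_diff {1} {act y 1})" "h = perm_map y \<circ> eps B"
    using assms(2) by (rule OG_E)
  have "labelled (x -` B) (sym_diff {act x 1} {act x (act y 1)})"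
    using labelled_vimage[OF g(1) h(3)] by (simp only: image_pair_act[OF g(1)])
  then have "labelled (sym_diff (x -` B) A) (sym_diff (sym_diff {act x 1} {act x (act y 1)}) (sym_diff {1} {act x 1}))"
    using g(3) by (rule labelled_sym_diff)
  moreover have "sym_diff (sym_diff {act x 1} {act x (act y 1)}) (sym_diff {1} {act x 1}) = sym_diff {1} {act (y \<circ> x) 1}"
    using act_comp[OF g(1) h(1)] by auto
  ultimately have "labelled (sym_diff (x -` B) A) (sym_diff {1} {act (y \<circ> x) 1})"
    by (simp only:)
  then show ?thesis
    unfolding g(4) h(4) monomial_comp[OF g(2) h(2)]
    by (rule OG_I[OF AGL42_comp[OF g(1) h(1)]])
qed

lemma OG_inv:
  assumes "h \<in> OG f"
  shows "\<exists>k\<in>OG f. k \<circ> h = id \<and> h \<circ> k = id"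
proof -
  obtain A x where h: "x \<in> carrier AGL42" "bij x" "labelled A (sym_diff {1} {act x 1})" "h = perm_map x \<circ> eps A"
    using assms by (rule OG_E)
  let ?y = "Hilbert_Choice.inv x"
  have y: "?y \<in> carrier AGL42" "bij ?y"
    using AGL42_inv[OF h(1)] AGL42_bij by blast+
  have xy: "?y \<circ> x = id" "x \<circ> ?y = id"
    using h(2) by (simp_all add: bij_is_inj bij_is_surj surj_iff[symmetric])
  have "labelled (?y -` A) (sym_diff {act ?y 1} {1})"
    using labelled_vimage[OF y(1) h(3)] by (simp only: image_pair_act[OF y(1)] act_inv[OF h(1)])
  then have k: "perm_map ?y \<circ> eps (?y -` A) \<in> OG f"
    by (intro OG_I[OF y(1)]) (simp only: Un_commute)
  have v: "x -` ?y -` A = A"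
    using xy(1) by (simp add: vimage_comp)
  have "(perm_map ?y \<circ> eps (?y -` A)) \<circ> h = id" "h \<circ> (perm_map ?y \<circ> eps (?y -` A)) = id"
    unfolding h(4) monomial_comp[OF h(2) y(2)] monomial_comp[OF y(2) h(2)] xy v
    by simp_all
  then show ?thesis
    using k by blast
qed

lemma OG_subgroup: "subgroup (OG f) orth_group"
proof (rule group.subgroupI[OF orth_group_group])
  show "OG f \<subseteq> carrier orth_group" "OG f \<noteq> {}"
    using OG_orthogonal OG_id by (auto simp: orth_group_carrier)
next
  fix h assume h: "h \<in> OG f"
  then obtain k where k: "k \<in> OG f" "h \<circ> k = id"
    using OG_inv by blast
  then have "inv\<^bsub>orth_group\<^esub> h = k"
    using h OG_orthogonal
    by (intro group.inv_equality[OF orth_group_group]) (simp_all add: orth_group_carrier orth_group_mult orth_group_one)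
  then show "inv\<^bsub>orth_group\<^esub> h \<in> OG f"
    using k(1) by simp
next
  fix g h assume "g \<in> OG f" "h \<in> OG f"
  then show "g \<otimes>\<^bsub>orth_group\<^esub> h \<in> OG f"
    by (simp add: orth_group_mult OG_comp)
qed

lemma OG_group_group: "group (OG_group f)"
  unfolding OG_group_def by (rule group.subgroup_imp_group[OF orth_group_group OG_subgroup])

lemma OC_eq: "OC f = (\<lambda>B. eps B x0) ` NR"
proof (intro equalityI subsetI)
  fix v assume "v \<in> OC f"
  then obtain h where "h \<in> OG f" "v = h x0"
    by (auto simp: OC_def)
  then obtain A x where h: "x \<in> carrier AGL42" "bij x" "labelled A (sym_diff {1} {act x 1})" "v = perm_map x (eps A x0)"
    by (elim OG_E) auto
  let ?y = "Hilbert_Choice.inv x"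
  have y: "?y \<in> carrier AGL42"
    using h(1) by (rule AGL42_inv)
  have "labelled (?y -` A) (sym_diff {act ?y 1} {1})"
    using labelled_vimage[OF y h(3)] by (simp only: image_pair_act[OF y] act_inv[OF h(1)])
  moreover have "act ?y 1 \<in> {1..8}"
    using permutes_in_image[OF act_carrier(1)[OF y]] by simp
  moreover have "sym_diff {act ?y 1} {1} = sym_diff {1} {act ?y 1}"
    by (rule Un_commute)
  ultimately have "x ` A \<in> NR"
    unfolding NR_def bij_vimage_eq_inv_image[OF bij_imp_bij_inv[OF h(2)]] inv_inv_eq[OF h(2)] by auto
  then show "v \<in> (\<lambda>B. eps B x0) ` NR"
    using h by (simp add: perm_map_eps)
next
  fix v assume "v \<in> (\<lambda>B. eps B x0) ` NR"
  then obtain B i where B: "v = eps B x0" "i \<in> {1..8}" "labelled B (sym_diff {1} {i})"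
    by (auto simp: NR_def)
  \<comment> \<open>Sending \<open>i\<close> to 1 makes the label of the preimage of
    \<open>B\<close> the pair \<open>{1, act x 1}\<close> that membership in the group
    demands.\<close>
  obtain p where p: "p permutes {1..8}" "evenperm p" "p i = 1"
    using even_permutation_moving[of i 1] B(2) by auto
  obtain x where x: "x \<in> carrier AGL42" "act x = p"
    using act_onto[OF p(1,2)] .
  have b: "bij x"
    using x(1) by (rule AGL42_bij)
  have "labelled (x -` B) (sym_diff {act x 1} {1})"
    using labelled_vimage[OF x(1) B(3)] by (simp only: image_pair_act[OF x(1)]) (simp only: x(2) p(3))
  then have "perm_map x \<circ> eps (x -` B) \<in> OG f"
    by (intro OG_I[OF x(1)]) (simp only: Un_commute)
  moreover have "v = (perm_map x \<circ> eps (x -` B)) x0"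
    using b by (simp add: B(1) perm_map_eps bij_is_surj surj_image_vimage_eq)
  ultimately show "v \<in> OC f"
    unfolding OC_def by blast
qed

lemma OG_image_OC:
  assumes "h \<in> OG f"
  shows "h ` OC f = OC f"
proof -
  have sub: "h ` OC f \<subseteq> OC f" if "h \<in> OG f" for h
  proof
    fix v assume "v \<in> h ` OC f"
    then obtain g where "g \<in> OG f" "v = (h \<circ> g) x0"
      by (auto simp: OC_def)
    then show "v \<in> OC f"
      using OG_comp[OF _ that] unfolding OC_def by blast
  qed
  obtain k where k: "k \<in> OG f" "h \<circ> k = id"
    using OG_inv[OF assms] by blast
  then have "OC f = h ` k ` OC f"
    by (simp add: image_comp)
  then show ?thesis
    using sub[OF assms] sub[OF k(1)] by blast
qed

text \<open>Either the four points have nonzero sum, and words of \<open>RM 1\<close> already flip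
  the sign, or they are the points of an affine plane, and the product of their signs depends only
  on the form. The case \<open>c = d\<close> falls under the first alternative.\<close>

lemma sum_NR_eq_0:
  assumes "a \<noteq> b" "\<not> (a = c \<and> b = d)" "\<not> (a = d \<and> b = c)"
  shows "(\<Sum>B\<in>NR. sgn_bit (word B $ a + word B $ b + word B $ c + word B $ d)) = 0"
proof (cases "a + b + c + d = 0")
  case False
  then obtain i where "(a + b + c + d) $ i \<noteq> 0"
    by (metis vec_eq_iff zero_index)
  then have i: "(a + b + c + d) $ i = 1"
    by (simp only: bit_not_zero_iff)
  \<comment> \<open>This hyperplane contains an odd number of the four points, counted with
    multiplicity, so adding it to a word reverses the sign.\<close>
  let ?H = "{x :: point. x $ i = 1}"
  have H: "?H \<in> RM 1"
    by (rule RM_UNIV_coordinate) simp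
  have "bij_betw (\<lambda>B. sym_diff B ?H) NR NR"
    by (rule bij_betwI[of _ _ _ "\<lambda>B. sym_diff B ?H"]) (auto intro!: NR_sym_diff_RM1[OF _ H])
  then have "(\<Sum>B\<in>NR. sgn_bit (word B $ a + word B $ b + word B $ c + word B $ d)) =
    (\<Sum>B\<in>NR. sgn_bit (word (sym_diff B ?H) $ a + word (sym_diff B ?H) $ b + word (sym_diff B ?H) $ c + word (sym_diff B ?H) $ d))"
    by (rule sum.reindex_bij_betw[symmetric])
  also have "\<dots> = (\<Sum>B\<in>NR. sgn_bit ((word B $ a + word B $ b + word B $ c + word B $ d) + 1))"
  proof (intro sum.cong refl arg_cong[of _ _ sgn_bit])
    fix B
    have "word ?H $ \<omega> = \<omega> $ i" for \<omega>
      by (simp add: word_nth)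
    then have "word ?H $ a + word ?H $ b + word ?H $ c + word ?H $ d = 1"
      using i by simp
    then show "word (sym_diff B ?H) $ a + word (sym_diff B ?H) $ b + word (sym_diff B ?H) $ c + word (sym_diff B ?H) $ d
        = word B $ a + word B $ b + word B $ c + word B $ d + 1"
      unfolding word_sym_diff vector_add_component bit_bool Rep_bit_simps by argo
  qed
  also have "\<dots> = - (\<Sum>B\<in>NR. sgn_bit (word B $ a + word B $ b + word B $ c + word B $ d))"
    by (simp add: sgn_bit_add sum_negf) (simp add: sgn_bit_def sum_negf)
  finally show ?thesis
    by simp
next
  case True
  \<comment> \<open>The hypotheses say precisely that the directions \<open>s\<close>,
    \<open>t\<close> and \<open>s + t\<close> are nonzero, as \<open>sum_form_rep\<close>
    requires.\<close>
  define s t where "s = a + b" and "t = a + c"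
  have d: "d = a + s + t" and b: "b = a + s" and c: "c = a + t"
    using True unfolding s_def t_def by (auto simp: vec_eq_iff bit_bool)
  have st: "s \<noteq> 0" "t \<noteq> 0" "t \<noteq> s"
    using assms unfolding d b c by (auto simp: add.assoc)
  have "(\<Sum>B\<in>NR. sgn_bit (word B $ a + word B $ b + word B $ c + word B $ d)) = (\<Sum>B\<in>NR. sgn_bit (form B s t))"
  proof (intro sum.cong refl arg_cong[of _ _ sgn_bit])
    fix B assume "B \<in> NR"
    then have "quadratic_word B"
      using labelled_RM2 RM2_quadratic unfolding NR_def by blast
    from quadratic_word.deriv2_eq_form[OF this, of a s t]
    show "word B $ a + word B $ b + word B $ c + word B $ d = form B s t"
      unfolding b c d deriv2_def .
  qed
  also have "\<dots> = (\<Sum>p\<in>{1..8} \<times> RM 1. sgn_bit (form (case p of (i, C) \<Rightarrow> sym_diff (rep i) C) s t))"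
    by (rule sum.reindex_bij_betw[OF NR_bij, symmetric])
  also have "\<dots> = (\<Sum>(i, C)\<in>{1..8} \<times> RM 1. sgn_bit (form (rep i) s t))"
  proof (intro sum.cong refl)
    fix p :: "nat \<times> point set" assume "p \<in> {1..8} \<times> RM 1"
    then have "form (snd p) s t = 0"
      using RM1_iff_form RM1_subset_RM2 by auto
    then show "sgn_bit (form (case p of (i, C) \<Rightarrow> sym_diff (rep i) C) s t) = (case p of (i, C) \<Rightarrow> sgn_bit (form (rep i) s t))"
      by (simp add: case_prod_beta form_sym_diff)
  qed
  also have "\<dots> = (\<Sum>i\<in>{1..8}. \<Sum>C\<in>RM 1. sgn_bit (form (rep i) s t))"
    by (rule sum.cartesian_product[symmetric])
  also have "\<dots> = real (card (RM 1)) * (\<Sum>i\<in>{1..8}. sgn_bit (form (rep i) s t))"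
    by (simp add: sum_distrib_left)
  finally show ?thesis
    by (simp add: sum_form_rep[OF st])
qed

text \<open>Expanding \<open>(\<Sum>B\<in>NR. \<chi>\<^sub>B(a) \<chi>\<^sub>B(b) (u \<bullet> \<chi>\<^sub>B)\<^sup>2)\<close>, only the terms with index set \<open>{a, b}\<close> survive.\<close>

lemma flat_vector_single_coordinate:
  fixes u :: V
  assumes flat: "\<And>B. B \<in> NR \<Longrightarrow> (u \<bullet> eps B x0)\<^sup>2 = 1" and ab: "a \<noteq> b"
  shows "u $ a * u $ b = 0"
proof -
  let ?\<chi> = "\<lambda>B \<omega>. sgn_bit (word B $ \<omega>)"
  let ?S = "\<lambda>c d. \<Sum>B\<in>NR. sgn_bit (word B $ a + word B $ b + word B $ c + word B $ d)"
  have diag: "?S c c = 0" for c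
    using ab by (intro sum_NR_eq_0) auto
  have S: "?S c d = (if c = a \<and> d = b then real (card NR) else 0) + (if c = b \<and> d = a then real (card NR) else 0)" for c d
  proof (cases "c = a \<and> d = b \<or> c = b \<and> d = a")
    case True
    then have "word B $ a + word B $ b + word B $ c + word B $ d = 0" for B
      by (auto simp: bit_bool)
    then show ?thesis
      using True ab by (simp only: sgn_bit_0) auto
  next
    case False
    then have "?S c d = 0"
      by (intro sum_NR_eq_0[OF ab]) blast+
    moreover have "\<not> (c = a \<and> d = b)" "\<not> (c = b \<and> d = a)"
      using False by blast+
    ultimately show ?thesis
      by (simp only: if_False add_0_left)
  qed
  \<comment> \<open>In \<open>?S a a\<close> the repeated point cancels, leaving the sum of
    \<open>?\<chi> B a * ?\<chi> B b\<close>; flatness allows the factor 1 to be replaced by the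
    squared inner product.\<close>
  have "0 = ?S a a"
    by (rule diag[symmetric])
  also have "\<dots> = (\<Sum>B\<in>NR. ?\<chi> B a * ?\<chi> B b * (u \<bullet> eps B x0)\<^sup>2)"
    by (intro sum.cong refl) (simp add: flat sgn_bit_add ac_simps)
  also have "\<dots> = (\<Sum>B\<in>NR. \<Sum>c\<in>UNIV. \<Sum>d\<in>UNIV. u $ c * u $ d * sgn_bit (word B $ a + word B $ b + word B $ c + word B $ d))"
  proof (intro sum.cong refl)
    fix B
    have "u \<bullet> eps B x0 = (\<Sum>c\<in>UNIV. u $ c * ?\<chi> B c)"
      by (simp add: inner_vec_def eps_x0_sgn del: eps_nth)
    then have sq: "(u \<bullet> eps B x0)\<^sup>2 = (\<Sum>c\<in>UNIV. \<Sum>d\<in>UNIV. (u $ c * ?\<chi> B c) * (u $ d * ?\<chi> B d))"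
      by (simp only: power2_eq_square sum_product)
    show "?\<chi> B a * ?\<chi> B b * (u \<bullet> eps B x0)\<^sup>2
        = (\<Sum>c\<in>UNIV. \<Sum>d\<in>UNIV. u $ c * u $ d * sgn_bit (word B $ a + word B $ b + word B $ c + word B $ d))"
      unfolding sq sum_distrib_left sgn_bit_add by (intro sum.cong refl) (simp only: mult_ac)
  qed
  also have "\<dots> = (\<Sum>c\<in>UNIV. \<Sum>d\<in>UNIV. u $ c * u $ d * ?S c d)"
    unfolding sum_distrib_left by (rule trans[OF sum.swap], rule sum.cong[OF refl], rule sum.swap)
  also have "\<dots> = (\<Sum>c\<in>UNIV. \<Sum>d\<in>UNIV. (if c = a \<and> d = b then u $ c * u $ d * real (card NR) else 0)
      + (if c = b \<and> d = a then u $ c * u $ d * real (card NR) else 0))"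
  proof -
    have distr: "x * ((if P then n else 0) + (if Q then n else 0)) = (if P then x * n else 0) + (if Q then x * n else 0)"
      for x n :: real and P Q
      by simp
    show ?thesis
      unfolding S distr ..
  qed
  also have "\<dots> = u $ a * u $ b * real (card NR) + u $ b * u $ a * real (card NR)"
    unfolding sum.distrib sum_sum_delta ..
  finally have "2 * (u $ a * u $ b) * real (card NR) = 0"
    by simp
  moreover have "card NR \<noteq> 0"
    using RM1_subset_NR RM_empty by (metis card_eq_0_iff empty_iff finite subsetD)
  ultimately show ?thesis
    by simp
qed

end

section \<open>The stabilizer of the code\<close>

context optimism
begin

lemma stabilizer_fixing_x0:
  assumes h: "orthogonal_transformation h" and OC: "h ` OC f = OC f" and fixes_x0: "h x0 = x0"
  shows "h \<in> OG f"
proof -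
  have single: "\<exists>\<nu>. h (axis \<omega> 1) = axis \<nu> 1" for \<omega>
  proof -
    let ?u = "h (axis \<omega> 1)"
    have flat: "(?u \<bullet> eps B x0)\<^sup>2 = 1" if "B \<in> NR" for B
    proof -
      have "eps B x0 \<in> h ` OC f"
        using that unfolding OC unfolding OC_eq by blast
      then obtain C where C: "eps B x0 = h (eps C x0)"
        unfolding OC_eq by blast
      have "?u \<bullet> eps B x0 = axis \<omega> 1 \<bullet> eps C x0"
        unfolding C using h by (simp add: orthogonal_transformation_def)
      then show ?thesis
        by (simp add: inner_axis')
    qed
    have zero: "?u $ a * ?u $ b = 0" if "a \<noteq> b" for a b
      using flat_vector_single_coordinate[OF flat that] .
    \<comment> \<open>Fixing \<open>x0\<close> makes the coordinate sum 1. This shows that a nonzero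
      coordinate exists and that it is 1, not -1.\<close>
    have "?u \<bullet> x0 = axis \<omega> 1 \<bullet> x0"
      using h fixes_x0 by (metis orthogonal_transformation_def)
    then have sum: "(\<Sum>a\<in>UNIV. ?u $ a) = 1"
      by (simp add: inner_axis') (simp add: inner_vec_def)
    then obtain \<nu> where \<nu>: "?u $ \<nu> \<noteq> 0"
      by (metis sum.neutral zero_neq_one)
    have others: "?u $ a = 0" if "a \<noteq> \<nu>" for a
      using zero[OF that] \<nu> by simp
    have "(\<Sum>a\<in>UNIV. ?u $ a) = (\<Sum>a\<in>UNIV. if a = \<nu> then ?u $ \<nu> else 0)"
      using others by (intro sum.cong) auto
    then have "?u $ \<nu> = 1"
      using sum by simp
    then have "?u $ a = axis \<nu> 1 $ a" for a
      using others[of a] by (cases "a = \<nu>") (simp_all add: axis_def)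
    then have "?u = axis \<nu> 1"
      by (rule vec_eq_iff[THEN iffD2, OF allI])
    then show ?thesis ..
  qed
  then obtain g where g: "\<And>\<omega>. h (axis \<omega> 1) = axis (g \<omega>) 1"
    by metis
  have "inj g"
  proof (rule injI)
    fix \<omega> \<nu> assume "g \<omega> = g \<nu>"
    then have "h (axis \<omega> 1) = h (axis \<nu> 1)"
      by (simp add: g)
    then have "axis \<omega> (1 :: real) = axis \<nu> 1"
      using orthogonal_transformation_inj[OF h] by (simp add: inj_eq)
    then show "\<omega> = \<nu>"
      by (simp add: axis_eq_axis)
  qed
  then have bij: "bij g"
    by (simp add: bij_def finite_UNIV_inj_surj)
  have hg: "h = perm_map g"
  proof
    fix v
    have "h v = h (\<Sum>\<omega>\<in>UNIV. v $ \<omega> *\<^sub>R axis \<omega> 1)"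
      by (simp add: basis_expansion flip: scalar_mult_eq_scaleR)
    also have "\<dots> = (\<Sum>\<omega>\<in>UNIV. v $ \<omega> *\<^sub>R h (axis \<omega> 1))"
      using orthogonal_transformation_linear[OF h] by (simp add: linear_sum linear_scale)
    finally show "h v = perm_map g v"
      by (simp add: perm_map_def g)
  qed
  have image: "g ` B \<in> NR" if "B \<in> NR" for B
  proof -
    have "h (eps B x0) \<in> OC f"
      using that OC unfolding OC_eq by blast
    then show ?thesis
      unfolding OC_eq hg perm_map_eps[OF bij] perm_map_x0[OF bij] image_iff eps_x0_inject by simp
  qed
  have vimage: "g -` B \<in> NR" if "B \<in> NR" for B
  proof -
    have "eps B x0 \<in> h ` OC f"
      using that unfolding OC unfolding OC_eq by blast
    then obtain C where C: "C \<in> NR" "eps B x0 = h (eps C x0)"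
      unfolding OC_eq by blast
    then have "B = g ` C"
      unfolding hg perm_map_eps[OF bij] perm_map_x0[OF bij] eps_x0_inject by simp
    then show ?thesis
      using C(1) bij by (simp add: bij_is_inj inj_vimage_image_eq)
  qed
  have "g \<in> carrier AGL42"
  proof (rule AGL42_iff[THEN iffD2], intro conjI allI bij)
    fix x y
    show "g (x + y) = g x + g y + g 0"
    proof (rule vec_eq_iff[THEN iffD2], rule allI)
      fix i
      \<comment> \<open>Since \<open>g\<close> preserves \<open>NR\<close> in both directions, it
        pulls words of the kernel back to words of the kernel. Applied to coordinate hyperplanes,
        this makes each coordinate of \<open>g\<close> an affine function.\<close>
      let ?H = "{x :: point. x $ i = 1}"
      have H: "?H \<in> RM 1"
        by (rule RM_UNIV_coordinate) simp
      have "g -` ?H \<in> RM 1"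
      proof (rule RM1_eq_kernel)
        fix B assume B: "B \<in> NR"
        have "g -` (sym_diff (g ` B) ?H) \<in> NR"
          using vimage NR_sym_diff_RM1[OF image[OF B] H] by blast
        moreover have "g -` (sym_diff (g ` B) ?H) = sym_diff (g -` ?H) B"
          unfolding vimage_Un vimage_Diff inj_vimage_image_eq[OF bij_is_inj[OF bij]] by (rule Un_commute)
        ultimately show "sym_diff (g -` ?H) B \<in> NR"
          by (simp only:)
      qed
      then have "deriv2 (\<lambda>x. word (g -` ?H) $ x) 0 x y = 0"
        by (rule RM1_deriv2)
      moreover have "word (g -` ?H) $ x = g x $ i" for x
        by (simp add: word_nth)
      ultimately have "g 0 $ i + g x $ i + g y $ i + g (x + y) $ i = 0"
        by (simp only: deriv2_def add_0_left)
      then show "g (x + y) $ i = (g x + g y + g 0) $ i"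
        by (simp only: vector_add_component bit_bool Rep_bit_simps) argo
    qed
  qed
  note g_AGL = this
  have "even_set (sym_diff {1} {act g 1})"
    using permutes_in_image[OF act_carrier(1)[OF g_AGL], of 1] by (intro even_set_pair) simp_all
  then obtain A where A: "labelled A (sym_diff {1} {act g 1})"
    using labelled_onto by blast
  \<comment> \<open>A group element with the same permutation part as \<open>h\<close>. Both
    preserve the code, so the sign change by \<open>A\<close> does too. Hence \<open>A\<close> lies
    in the kernel and the label required for \<open>g\<close> is the empty one up to complement,
    which the empty word carries.\<close>
  let ?k = "perm_map g \<circ> eps A"
  have k: "?k \<in> OG f"
    by (rule OG_I[OF g_AGL A])
  have "A \<in> RM 1"
  proof (rule RM1_eq_kernel)
    fix B assume "B \<in> NR"
    then have "?k (eps B x0) \<in> h ` OC f"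
      using OG_image_OC[OF k] unfolding OC unfolding OC_eq by blast
    then obtain C where C: "C \<in> NR" "perm_map g (eps (sym_diff A B) x0) = perm_map g (eps C x0)"
      unfolding OC_eq hg by (auto simp: eps_comp)
    then have "eps (sym_diff A B) x0 = eps C x0"
      using orthogonal_transformation_inj[OF h] unfolding hg by (simp only: inj_eq)
    then show "sym_diff A B \<in> NR"
      using C(1) unfolding eps_x0_inject by simp
  qed
  then have "labelled A {}"
    by (simp only: labelled_empty_iff)
  from labelled_sym_diff[OF this A] have "labelled {} (sym_diff {1} {act g 1})"
    by simp
  from OG_I[OF g_AGL this] show ?thesis
    by (simp add: hg)
qed

lemma stabilizer_eq_OG: "{h. orthogonal_transformation h \<and> h ` OC f = OC f} = OG f"
proof (intro equalityI subsetI CollectI conjI)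
  fix h assume "h \<in> {h. orthogonal_transformation h \<and> h ` OC f = OC f}"
  then have h: "orthogonal_transformation h" "h ` OC f = OC f"
    by simp_all
  have "x0 \<in> OC f"
    unfolding OC_def by (rule image_eqI[OF _ OG_id]) simp
  then have "h x0 \<in> OC f"
    using h(2) by blast
  then obtain g where g: "g \<in> OG f" "h x0 = g x0"
    unfolding OC_def by blast
  obtain k where k: "k \<in> OG f" "k \<circ> g = id" "g \<circ> k = id"
    using OG_inv[OF g(1)] by blast
  have "k \<circ> h \<in> OG f"
  proof (rule stabilizer_fixing_x0)
    show "orthogonal_transformation (k \<circ> h)"
      using OG_orthogonal[OF k(1)] h(1) by (rule orthogonal_transformation_compose)
    show "(k \<circ> h) ` OC f = OC f"
      by (simp only: image_comp[symmetric] h(2) OG_image_OC[OF k(1)])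
    show "(k \<circ> h) x0 = x0"
      using g(2) k(2) by (metis comp_apply id_apply)
  qed
  then have "g \<circ> (k \<circ> h) \<in> OG f"
    using g(1) by (rule OG_comp)
  then show "h \<in> OG f"
    by (simp add: o_assoc k(3))
qed (simp_all add: OG_orthogonal OG_image_OC)

end

section \<open>Fixed points of p-groups and GL(4,2)\<close>

text \<open>Every orbit has p-power size; without a fixed point all these sizes would be divisible
  by p, and so would the size of \<open>E\<close>.\<close>

lemma (in group_action) p_group_fixed_point:
  assumes p: "prime p" "order G = p ^ k" and E: "finite E" "\<not> p dvd card E"
  shows "\<exists>x\<in>E. \<forall>g\<in>carrier G. \<phi> g x = x"
proof (rule ccontr)
  assume no_fixed: "\<not> ?thesis"
  have "p dvd card orb" if orb: "orb \<in> orbits G E \<phi>" for orb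
  proof -
    obtain x where x: "x \<in> E" "orb = orbit G \<phi> x"
      using orb by (auto simp: orbits_def)
    have "card orb dvd p ^ k"
      using orbit_stabilizer_theorem[OF x(1)] p(2) x(2) by (metis dvd_triv_left)
    then obtain i where i: "card orb = p ^ i"
      using p(1) divides_primepow_nat by blast
    have "i \<noteq> 0"
    proof
      assume "i = 0"
      then have "card orb = 1"
        using i by simp
      then obtain y where y: "orb = {y}"
        by (metis card_1_singletonE)
      have "\<phi> g x = x" if "g \<in> carrier G" for g
      proof -
        have "x \<in> orb" "\<phi> g x \<in> orb"
          using orbit_refl[OF x(1)] that x(2) by (auto simp: orbit_def)
        then show ?thesis
          by (simp add: y)
      qed
      then show False
        using no_fixed x(1) by blast
    qed
    then show ?thesis
      by (simp add: i)
  qed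
  moreover have "card E = (\<Sum>orb\<in>orbits G E \<phi>. card orb)"
    using disjoint_sum[OF E(1), of "\<lambda>x. 1 :: nat"] by simp
  ultimately show False
    using E(2) by (metis dvd_sum)
qed

lemma (in group) comm_group_if_involutions:
  assumes "\<And>x. x \<in> carrier G \<Longrightarrow> x \<otimes> x = \<one>"
  shows "comm_group G"
proof (rule group_comm_groupI)
  have inv: "inv x = x" if "x \<in> carrier G" for x
    using that assms by (intro inv_equality)
  show "x \<otimes> y = y \<otimes> x" if "x \<in> carrier G" "y \<in> carrier G" for x y
    using that inv_mult_group[OF that] by (simp add: inv)
qed

section \<open>Transitivity of the general linear group on nonzero vectors\<close>

lemma GL42_carrier: "M \<in> carrier GL42 \<longleftrightarrow> invertible M"
  by (simp add: GL42_def)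

lemma GL42_mult: "M \<otimes>\<^bsub>GL42\<^esub> N = M ** N"
  by (simp add: GL42_def)

lemma GL42_one: "\<one>\<^bsub>GL42\<^esub> = mat 1"
  by (simp add: GL42_def)

lemma GL42_group: "group GL42"
proof (rule groupI)
  fix M assume "M \<in> carrier GL42"
  then obtain N where "M ** N = mat 1" "N ** M = mat 1"
    by (auto simp: GL42_carrier invertible_def)
  then have "invertible N"
    by (auto simp: invertible_def)
  then show "\<exists>N\<in>carrier GL42. N \<otimes>\<^bsub>GL42\<^esub> M = \<one>\<^bsub>GL42\<^esub>"
    using \<open>N ** M = mat 1\<close> by (auto simp: GL42_carrier GL42_mult GL42_one)
next
  have "invertible (mat 1 :: bit^4^4)"
    unfolding invertible_def using matrix_mul_lid by blast
  then show "\<one>\<^bsub>GL42\<^esub> \<in> carrier GL42"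
    by (simp add: GL42_carrier GL42_one)
qed (auto simp: GL42_carrier GL42_mult GL42_one invertible_mult matrix_mul_assoc)

text \<open>If no single coordinate is 1 on both vectors, the sum of one coordinate chosen for
  \<open>x\<close> and one chosen for \<open>w\<close> is.\<close>

lemma bitvec_common_functional:
  fixes x w :: "bit ^ 'n"
  assumes "x \<noteq> 0" "w \<noteq> 0"
  shows "\<exists>c :: bit ^ 'n. (\<Sum>j\<in>UNIV. c $ j * x $ j) = 1 \<and> (\<Sum>j\<in>UNIV. c $ j * w $ j) = 1"
proof -
  have ax: "(\<Sum>j\<in>UNIV. axis i 1 $ j * y $ j) = y $ i" for i and y :: "bit ^ 'n"
  proof -
    have "(\<Sum>j\<in>UNIV. axis i 1 $ j * y $ j) = (\<Sum>j\<in>UNIV. if j = i then y $ j else 0)"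
      by (intro sum.cong) (auto simp: axis_def)
    then show ?thesis
      by simp
  qed
  obtain i where i: "x $ i = 1"
    using assms(1) by (metis bit_not_zero_iff vec_eq_iff zero_index)
  obtain j where j: "w $ j = 1"
    using assms(2) by (metis bit_not_zero_iff vec_eq_iff zero_index)
  show ?thesis
  proof (cases "w $ i = 1 \<or> x $ j = 1")
    case True
    then show ?thesis
      using i j by (metis ax)
  next
    case False
    then have "x $ j = 0" "w $ i = 0"
      by simp_all
    then show ?thesis
      using i j by (intro exI[of _ "axis i 1 + axis j 1"]) (simp add: ax distrib_right sum.distrib)
  qed
qed

text \<open>A transvection with functional \<open>c\<close> and centre \<open>x + w\<close> interchanges \<open>x\<close> and \<open>w\<close>.\<close>

lemma GL_transitive:
  fixes x w :: "bit ^ 'n"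
  assumes "x \<noteq> 0" "w \<noteq> 0"
  shows "\<exists>M :: bit ^ 'n ^ 'n. invertible M \<and> M *v x = w"
proof -
  obtain c :: "bit ^ 'n" where c: "(\<Sum>j\<in>UNIV. c $ j * x $ j) = 1" "(\<Sum>j\<in>UNIV. c $ j * w $ j) = 1"
    using bitvec_common_functional[OF assms] by blast
  define M :: "bit ^ 'n ^ 'n" where "M = (\<chi> i j. (if i = j then 1 else 0) + (x + w) $ i * c $ j)"
  have M: "M *v y = y + (\<Sum>j\<in>UNIV. c $ j * y $ j) *s (x + w)" for y
  proof (rule vec_eq_iff[THEN iffD2], rule allI)
    fix i
    have "(M *v y) $ i = (\<Sum>j\<in>UNIV. (if j = i then y $ j else 0) + (x + w) $ i * (c $ j * y $ j))"
      unfolding M_def matrix_vector_mult_def by (auto simp: distrib_right mult.assoc intro!: sum.cong)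
    also have "\<dots> = y $ i + (x + w) $ i * (\<Sum>j\<in>UNIV. c $ j * y $ j)"
      by (simp only: sum.distrib sum_distrib_left sum.delta finite UNIV_I if_True)
    finally show "(M *v y) $ i = (y + (\<Sum>j\<in>UNIV. c $ j * y $ j) *s (x + w)) $ i"
      by (simp only: vector_add_component vector_smult_component mult.commute)
  qed
  \<comment> \<open>The functional vanishes on the centre because 1 + 1 = 0, so the transvection is
    an involution and thereby invertible.\<close>
  have "M *v (M *v y) = y" for y
  proof -
    have "(\<Sum>j\<in>UNIV. c $ j * (x + w) $ j) = 0"
      using c by (simp add: distrib_left sum.distrib)
    then have "M *v (x + w) = x + w"
      unfolding M by simp
    moreover have "M *v (y + k *s (x + w)) = M *v y + k *s (M *v (x + w))" for k
      by (simp add: matrix_vector_right_distrib vector_scalar_commute)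
    ultimately have "M *v (M *v y) = M *v y + (\<Sum>j\<in>UNIV. c $ j * y $ j) *s (x + w)"
      by (simp only: M[of y])
    then show ?thesis
      unfolding M[of y] by (simp only: add.assoc bitvec_add_self add_0_right)
  qed
  then have "M ** M = mat 1"
    by (simp add: matrix_eq matrix_vector_mul_assoc[symmetric])
  moreover have "M *v x = w"
    unfolding M by (simp add: c)
  ultimately show ?thesis
    unfolding invertible_def by blast
qed

lemma normal_two_subgroup_subset_kernel:
  assumes hom: "group_hom G GL42 h" and onto: "h ` carrier G = carrier GL42"
    and N: "N \<lhd> G" and card: "card N = 2 ^ k"
  shows "N \<subseteq> kernel G GL42 h"
proof -
  interpret h: group_hom G GL42 h
    by (rule hom)
  interpret N: normal N G
    by (rule N)
  let ?G = "G\<lparr>carrier := N\<rparr>"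
  let ?E = "{v :: point. v \<noteq> 0}"
  \<comment> \<open>Elements of \<open>BijGroup\<close> are extensional, hence the restriction.
    Column vectors turn the matrix product into the left action that \<open>group_action\<close>
    expects.\<close>
  let ?act = "\<lambda>g. \<lambda>v\<in>?E. h g *v v"
  have inv: "invertible (h g)" if "g \<in> carrier G" for g
    using h.hom_closed[OF that] by (simp add: GL42_carrier)
  have act_ne: "h g *v v \<noteq> 0" if g: "g \<in> carrier G" and v: "v \<noteq> 0" for g v
  proof
    obtain M where M: "M ** h g = mat 1"
      using inv[OF g] by (auto simp: invertible_def)
    assume "h g *v v = 0"
    then have "M *v (h g *v v) = 0"
      by simp
    then show False
      using v by (simp add: matrix_vector_mul_assoc M)
  qed
  have mult: "h (g1 \<otimes>\<^bsub>G\<^esub> g2) *v v = h g1 *v (h g2 *v v)" if "g1 \<in> carrier G" "g2 \<in> carrier G" for g1 g2 v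
    using that by (simp add: GL42_mult matrix_vector_mul_assoc)
  have one: "h \<one>\<^bsub>G\<^esub> *v v = v" for v
    by (simp add: GL42_one)
  have bij: "?act g \<in> Bij ?E" if g: "g \<in> carrier G" for g
  proof -
    have "bij_betw (?act g) ?E ?E"
    proof (rule bij_betwI[where g = "?act (inv\<^bsub>G\<^esub> g)"])
      show "?act g \<in> ?E \<rightarrow> ?E" "?act (inv\<^bsub>G\<^esub> g) \<in> ?E \<rightarrow> ?E"
        using act_ne[OF g] act_ne[OF h.G.inv_closed[OF g]] by (simp_all add: Pi_iff del: h.hom_inv)
      show "?act (inv\<^bsub>G\<^esub> g) (?act g v) = v" "?act g (?act (inv\<^bsub>G\<^esub> g) v) = v" if "v \<in> ?E" for v
        using that g act_ne[OF g] act_ne[OF h.G.inv_closed[OF g]]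
        by (simp_all add: mult[symmetric] GL42_one del: h.hom_inv h.hom_mult)
    qed
    then show ?thesis
      by (simp add: Bij_def)
  qed
  interpret act: group_action ?G ?E ?act
  proof (unfold group_action_def group_hom_def group_hom_axioms_def, intro conjI)
    show "group ?G"
      by (rule h.G.subgroup_imp_group[OF N.is_subgroup])
    show "group (BijGroup ?E)"
      by (rule group_BijGroup)
    show "?act \<in> hom ?G (BijGroup ?E)"
    proof (rule homI)
      show "?act g \<in> carrier (BijGroup ?E)" if "g \<in> carrier ?G" for g
        using bij[of g] that N.subset by (auto simp: BijGroup_def)
      show "?act (g1 \<otimes>\<^bsub>?G\<^esub> g2) = ?act g1 \<otimes>\<^bsub>BijGroup ?E\<^esub> ?act g2"
        if g12: "g1 \<in> carrier ?G" "g2 \<in> carrier ?G" for g1 g2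
      proof -
        have "g1 \<in> carrier G" "g2 \<in> carrier G"
          using g12 N.subset by auto
        then show ?thesis
          using bij act_ne by (auto simp: BijGroup_def compose_def mult restrict_def fun_eq_iff simp del: h.hom_mult)
      qed
    qed
  qed
  have "card ?E = 15"
  proof -
    have "?E = UNIV - {0}"
      by auto
    then show ?thesis
      by (simp add: card_Diff_subset CARD_bit)
  qed
  then have "\<exists>x\<in>?E. \<forall>g\<in>carrier ?G. ?act g x = x"
    using card by (intro act.p_group_fixed_point[of 2 k]) (simp_all add: order_def)
  then obtain x where x: "x \<noteq> 0" "\<And>g. g \<in> N \<Longrightarrow> h g *v x = x"
    by auto
  show ?thesis
  proof
    fix n assume n: "n \<in> N"
    have "h n *v w = w" for w
    proof (cases "w = 0")
      case False
      then obtain M :: "bit^4^4" where M: "invertible M" "M *v x = w"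
        using GL_transitive[OF x(1)] by blast
      then obtain g where g: "g \<in> carrier G" "h g = M"
        using onto GL42_carrier by (metis imageE)
      \<comment> \<open>Normality moves the fixed vector: this conjugate of \<open>n\<close> fixes
        \<open>x\<close> exactly when \<open>n\<close> fixes \<open>h g *v x\<close>, which is
        \<open>w\<close>.\<close>
      have "inv\<^bsub>G\<^esub> g \<otimes>\<^bsub>G\<^esub> n \<otimes>\<^bsub>G\<^esub> g \<in> N"
        using N.inv_op_closed1[OF g(1) n] .
      then have "h (inv\<^bsub>G\<^esub> g \<otimes>\<^bsub>G\<^esub> n \<otimes>\<^bsub>G\<^esub> g) *v x = x"
        by (rule x(2))
      then have "h (inv\<^bsub>G\<^esub> g) *v (h n *v (h g *v x)) = x"
        using g(1) n N.subset by (simp only: mult h.G.m_closed h.G.inv_closed subsetD)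
      then have "h g *v (h (inv\<^bsub>G\<^esub> g) *v (h n *v w)) = w"
        by (simp add: g(2) M(2))
      then show ?thesis
        using g(1) by (simp add: mult[symmetric] GL42_one del: h.hom_inv h.hom_mult)
    qed simp
    then have "h n = mat 1"
      by (simp add: matrix_eq)
    then show "n \<in> kernel G GL42 h"
      using n N.subset by (auto simp: kernel_def GL42_one)
  qed
qed

section \<open>The largest normal 2-subgroup\<close>

lemma monomial_inject:
  assumes "bij x" "bij y"
  shows "perm_map x \<circ> eps A = perm_map y \<circ> eps B \<longleftrightarrow> x = y \<and> A = B"
proof
  assume eq: "perm_map x \<circ> eps A = perm_map y \<circ> eps B"
  have "x \<omega> = y \<omega>" for \<omega>
  proof (rule ccontr)
    assume ne: "x \<omega> \<noteq> y \<omega>"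
    obtain \<nu> where \<nu>: "x \<omega> = y \<nu>"
      using assms(2) by (metis bij_pointE)
    have "perm_map x (eps A (axis \<omega> 1)) $ x \<omega> = perm_map y (eps B (axis \<omega> 1)) $ y \<nu>"
      using eq \<nu> by (metis comp_apply)
    then have "eps A (axis \<omega> 1) $ \<omega> = eps B (axis \<omega> 1) $ \<nu>"
      by (simp only: perm_map_nth assms)
    moreover have "\<nu> \<noteq> \<omega>"
      using ne \<nu> by metis
    ultimately show False
      by (simp add: axis_def split: if_splits)
  qed
  then have xy: "x = y"
    by (rule ext)
  have "perm_map x (eps A v) = perm_map x (eps B v)" for v
    using eq xy by (metis comp_apply)
  then have "eps A v = eps B v" for v
    using orthogonal_transformation_inj[OF orthogonal_transformation_perm_map[OF assms(1)]]
    by (metis injD)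
  then have "A = B"
    by (metis eps_x0_inject)
  with xy show "x = y \<and> A = B" ..
qed simp

definition affine_matrix :: "(point \<Rightarrow> point) \<Rightarrow> bit^4^4" where
  "affine_matrix x = (\<chi> i. x (axis i 1) + x 0)"

lemma affine_matrix_mult:
  assumes "x \<in> carrier AGL42"
  shows "\<omega> v* affine_matrix x = x \<omega> + x 0"
proof (rule vec_eq_iff[THEN iffD2], rule allI)
  fix j
  have "(x (\<omega> + \<nu>) + x 0) $ j = (x \<omega> + x 0) $ j + (x \<nu> + x 0) $ j" for \<omega> \<nu>
    by (simp only: AGL42_add[OF assms, of \<omega> \<nu>] vector_add_component bit_bool Rep_bit_simps) argo
  then have "(x \<omega> + x 0) $ j = (\<Sum>i\<in>UNIV. \<omega> $ i * (x (axis i 1) + x 0) $ j)"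
    by (rule bit_additive_expand)
  then show "(\<omega> v* affine_matrix x) $ j = (x \<omega> + x 0) $ j"
    by (simp add: vector_matrix_mult_def affine_matrix_def mult.commute)
qed

lemma vector_matrix_eq_iff: "M = N \<longleftrightarrow> (\<forall>\<omega>. \<omega> v* M = \<omega> v* N)" for M N :: "bit^'n^'m"
  by (metis matrix_eq transpose_iff transpose_matrix_vector)

text \<open>Row vectors reverse composition in the same way as the product of \<open>AGL42\<close>,
  so the linear part becomes a homomorphism.\<close>

lemma affine_matrix_comp:
  assumes "x \<in> carrier AGL42" "y \<in> carrier AGL42"
  shows "affine_matrix (y \<circ> x) = affine_matrix x ** affine_matrix y"
proof (unfold vector_matrix_eq_iff, rule allI)
  fix \<omega>
  have "\<omega> v* (affine_matrix x ** affine_matrix y) = (x \<omega> + x 0) v* affine_matrix y"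
    by (simp only: vector_matrix_mul_assoc[symmetric] affine_matrix_mult[OF assms(1)])
  also have "\<dots> = (y (x \<omega>) + y 0) + (y (x 0) + y 0)"
    by (simp only: vector_matrix_left_distrib) (simp only: affine_matrix_mult[OF assms(2)])
  also have "\<dots> = \<omega> v* affine_matrix (y \<circ> x)"
    unfolding affine_matrix_mult[OF AGL42_comp[OF assms]] o_apply AGL42_add[OF assms(2), of "x \<omega>" "x 0"]
    by (simp only: bitvec_ac)
  finally show "\<omega> v* affine_matrix (y \<circ> x) = \<omega> v* (affine_matrix x ** affine_matrix y)" ..
qed

lemma affine_matrix_eq_1_iff:
  assumes "x \<in> carrier AGL42"
  shows "affine_matrix x = mat 1 \<longleftrightarrow> x \<in> translation_subgroup"
  unfolding vector_matrix_eq_iff affine_matrix_mult[OF assms] translation_subgroup_iff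
  using assms by simp

lemma affine_matrix_invertible:
  assumes "x \<in> carrier AGL42"
  shows "invertible (affine_matrix x)"
proof -
  let ?y = "Hilbert_Choice.inv x"
  have y: "?y \<in> carrier AGL42"
    using assms by (rule AGL42_inv)
  have "?y \<circ> x = id" "x \<circ> ?y = id"
    using AGL42_bij[OF assms] by (simp_all add: bij_is_inj bij_is_surj surj_iff[symmetric])
  moreover have "affine_matrix id = mat 1"
    using affine_matrix_eq_1_iff[of id] by (simp add: translation_subgroup_iff)
  ultimately show ?thesis
    using affine_matrix_comp[OF assms y] affine_matrix_comp[OF y assms] unfolding invertible_def by metis
qed

lemma affine_matrix_onto:
  assumes "invertible M"
  obtains x where "x \<in> carrier AGL42" "affine_matrix x = M"
proof -
  obtain N where N: "M ** N = mat 1" "N ** M = mat 1"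
    using assms by (auto simp: invertible_def)
  let ?x = "\<lambda>\<omega>. \<omega> v* M"
  have "bij ?x"
    by (rule o_bij[of "\<lambda>\<omega>. \<omega> v* N"]) (simp_all add: fun_eq_iff vector_matrix_mul_assoc N)
  then have x: "?x \<in> carrier AGL42"
    by (simp add: AGL42_iff vector_matrix_left_distrib)
  moreover have "affine_matrix ?x = M"
    unfolding vector_matrix_eq_iff affine_matrix_mult[OF x] by simp
  ultimately show thesis
    by (rule that)
qed

lemma RM1_word_add:
  assumes "A \<in> RM 1"
  shows "word A $ (x + y) = word A $ x + word A $ y + word A $ 0"
  using RM1_deriv2[OF assms, of 0 x y]
  by (simp only: deriv2_def add_0_left bit_bool Rep_bit_simps) argo

lemma RM1_UNIV [simp]: "UNIV \<in> RM 1"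
  by (rule RM_UNIV_coordinate) simp

text \<open>An affine function is a constant plus a dot product, which gives 2 times 16
  choices.\<close>

lemma card_RM1: "card (RM 1) = 32"
proof -
  let ?f = "\<lambda>(c, v). {x :: point. c + (\<Sum>i\<in>UNIV. x $ i * v $ i) = 1}"
  have nth: "word (?f p) $ x = fst p + (\<Sum>i\<in>UNIV. x $ i * snd p $ i)" for p x
    by (cases p) (simp add: word_nth bit_bool)
  have "bij_betw ?f (UNIV :: (bit \<times> point) set) (RM 1)"
  proof (rule bij_betwI')
    fix p q :: "bit \<times> point"
    show "?f p = ?f q \<longleftrightarrow> p = q"
    proof
      assume "?f p = ?f q"
      then have "word (?f p) $ x = word (?f q) $ x" for x
        by (simp only:)
      then have eq: "fst p + (\<Sum>i\<in>UNIV. x $ i * snd p $ i) = fst q + (\<Sum>i\<in>UNIV. x $ i * snd q $ i)" for x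
        unfolding nth .
      have ax: "(\<Sum>i\<in>UNIV. axis j 1 $ i * v $ i) = v $ j" for j and v :: point
      proof -
        have "(\<Sum>i\<in>UNIV. axis j 1 $ i * v $ i) = (\<Sum>i\<in>UNIV. if i = j then v $ i else 0)"
          by (intro sum.cong) (auto simp: axis_def)
        then show ?thesis
          by simp
      qed
      have "fst p = fst q"
        using eq[of 0] by simp
      moreover from this have "snd p $ j = snd q $ j" for j
        using eq[of "axis j 1"] by (simp add: ax)
      then have "snd p = snd q"
        by (simp add: vec_eq_iff)
      ultimately show "p = q"
        by (simp add: prod_eq_iff)
    qed simp
    show "?f p \<in> RM 1"
      unfolding RM1_iff nth deriv2_def vector_add_component distrib_right sum.distrib
      by (simp only: bit_ac simp_thms)
  next
    fix A assume A: "A \<in> RM 1"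
    let ?v = "\<chi> i. word A $ axis i 1 + word A $ 0"
    have *: "word A $ x + word A $ 0 = (\<Sum>i\<in>UNIV. x $ i * (word A $ axis i 1 + word A $ 0))" for x
      by (rule bit_additive_expand[of "\<lambda>x. word A $ x + word A $ 0"])
        (simp only: RM1_word_add[OF A, of "_ :: point" "_ :: point"] bit_bool Rep_bit_simps, argo)
    have "word A $ x = word A $ 0 + (\<Sum>i\<in>UNIV. x $ i * ?v $ i)" for x
      using *[of x] by (simp add: bit_bool) argo
    then have "word A $ x = word (?f (word A $ 0, ?v)) $ x" for x
      unfolding nth fst_conv snd_conv .
    then have "word A = word (?f (word A $ 0, ?v))"
      by (rule vec_eq_iff[THEN iffD2, OF allI])
    then show "\<exists>p\<in>UNIV. A = ?f p"
      by (intro bexI[of _ "(word A $ 0, ?v)"]) (simp_all only: word_eq_iff UNIV_I)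
  qed
  then have "card (RM 1) = card (UNIV :: (bit \<times> point) set)"
    by (rule bij_betw_same_card[symmetric])
  then show ?thesis
    by (simp add: card_point CARD_bit)
qed

section \<open>The extraspecial group of translations and affine sign changes\<close>

definition shift :: "point \<Rightarrow> point \<Rightarrow> point" where
  "shift a = (\<lambda>x. x + a)"

definition shift_eps :: "point \<Rightarrow> point set \<Rightarrow> V \<Rightarrow> V" where
  "shift_eps a A = perm_map (shift a) \<circ> eps A"

definition D1T :: "(V \<Rightarrow> V) set" where
  "D1T = {shift_eps a A | a A. A \<in> RM 1}"

lemma shift_AGL42: "shift a \<in> carrier AGL42"
  unfolding shift_def by (rule translation_AGL42)

lemma shift_bij: "bij (shift a)"
  by (rule AGL42_bij[OF shift_AGL42])

lemma shift_comp: "shift b \<circ> shift a = shift (a + b)"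
  by (simp add: shift_def fun_eq_iff add.assoc)

lemma shift_0 [simp]: "shift 0 = id"
  by (simp add: shift_def fun_eq_iff)

lemma shift_translation: "shift a \<in> translation_subgroup"
  unfolding shift_def translation_subgroup_def by blast

text \<open>A translation changes an affine function by a constant. This is why squares in
  \<open>D1T\<close> are \<open>id\<close> or \<open>eps UNIV\<close>.\<close>

lemma shift_vimage:
  assumes "A \<in> RM 1"
  shows "shift a -` A = (if word A $ a = word A $ 0 then A else - A)"
proof -
  have "x \<in> shift a -` A \<longleftrightarrow> x \<in> (if word A $ a = word A $ 0 then A else - A)" for x
    using RM1_word_add[OF assms, of x a]
    by (simp add: shift_def bit_bool) argo
  then show ?thesis
    by blast
qed

lemma shift_vimage_RM1: "A \<in> RM 1 \<Longrightarrow> shift a -` A \<in> RM 1"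
  by (rule RM1_vimage[OF shift_AGL42])

lemma shift_eps_mult:
  "shift_eps a A \<otimes>\<^bsub>orth_group\<^esub> shift_eps b B = shift_eps (a + b) (sym_diff (shift a -` B) A)"
  unfolding shift_eps_def orth_group_mult monomial_comp[OF shift_bij shift_bij] by (simp add: shift_comp)

lemma shift_eps_inject: "shift_eps a A = shift_eps b B \<longleftrightarrow> a = b \<and> A = B"
proof -
  have "shift a = shift b \<longleftrightarrow> a = b"
    by (auto simp: shift_def fun_eq_iff)
  then show ?thesis
    unfolding shift_eps_def monomial_inject[OF shift_bij shift_bij] by simp
qed

lemma shift_eps_0: "shift_eps 0 A = eps A"
  by (simp add: shift_eps_def)

lemma id_eq_shift_eps: "id = shift_eps 0 {}"
  by (simp add: shift_eps_def)

lemma card_D1T: "card D1T = 2 ^ 9"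
proof -
  have "D1T = (\<lambda>(a, A). shift_eps a A) ` (UNIV \<times> RM 1)"
    by (auto simp: D1T_def)
  moreover have "inj_on (\<lambda>(a, A). shift_eps a A) (UNIV \<times> RM 1)"
    by (auto simp: inj_on_def shift_eps_inject)
  ultimately have "card D1T = card (UNIV :: point set) * card (RM 1)"
    by (metis card_image card_cartesian_product)
  then show ?thesis
    unfolding card_RM1 card_point by simp
qed

lemma shift_eps_square:
  assumes "A \<in> RM 1"
  shows "shift_eps a A \<otimes>\<^bsub>orth_group\<^esub> shift_eps a A \<in> {id, eps UNIV}"
proof -
  have "sym_diff (shift a -` A) A = {} \<or> sym_diff (shift a -` A) A = UNIV"
    unfolding shift_vimage[OF assms] by auto
  then show ?thesis
    unfolding shift_eps_mult by (auto simp: shift_eps_0)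
qed

text \<open>Each side pairs the linear part of one word with the translation of the other element;
  their sum is the symplectic commutator form.\<close>

lemma shift_eps_commute_iff:
  assumes "A \<in> RM 1" "B \<in> RM 1"
  shows "shift_eps a A \<otimes>\<^bsub>orth_group\<^esub> shift_eps b B = shift_eps b B \<otimes>\<^bsub>orth_group\<^esub> shift_eps a A \<longleftrightarrow>
    word A $ b + word A $ 0 = word B $ a + word B $ 0"
proof -
  have "sym_diff (shift a -` B) A = sym_diff (shift b -` A) B \<longleftrightarrow>
      (word A $ b = word A $ 0 \<longleftrightarrow> word B $ a = word B $ 0)"
    unfolding shift_vimage[OF assms(1)] shift_vimage[OF assms(2)] by auto
  then show ?thesis
    unfolding shift_eps_mult shift_eps_inject by (simp add: add.commute bit_bool) argo
qed

definition D1T_group :: "(V \<Rightarrow> V) monoid" where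
  "D1T_group = orth_group\<lparr>carrier := D1T\<rparr>"

lemma D1T_group_simps [simp]:
  "carrier D1T_group = D1T" "\<one>\<^bsub>D1T_group\<^esub> = id"
  "g \<otimes>\<^bsub>D1T_group\<^esub> h = g \<otimes>\<^bsub>orth_group\<^esub> h"
  by (simp_all add: D1T_group_def orth_group_one)

lemma D1T_subgroup: "subgroup D1T orth_group"
proof (rule group.subgroupI[OF orth_group_group])
  show "D1T \<subseteq> carrier orth_group"
    by (auto simp: D1T_def shift_eps_def orth_group_carrier orthogonal_transformation_compose
        orthogonal_transformation_eps orthogonal_transformation_perm_map shift_bij)
  then have sub: "g \<in> carrier orth_group" if "g \<in> D1T" for g
    using that by blast
  have "shift_eps 0 {} \<in> D1T"
    unfolding D1T_def using RM_empty by blast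
  then show "D1T \<noteq> {}"
    by blast
  show "inv\<^bsub>orth_group\<^esub> g \<in> D1T" if g': "g \<in> D1T" for g
  proof -
    obtain a A where g: "g = shift_eps a A" "A \<in> RM 1"
      using g' unfolding D1T_def by blast
    have vv: "shift a -` shift a -` A = A"
      by (simp add: vimage_comp shift_comp)
    have k: "shift_eps a (shift a -` A) \<in> D1T"
      using shift_vimage_RM1[OF g(2)] by (auto simp: D1T_def)
    have "shift_eps a (shift a -` A) \<otimes>\<^bsub>orth_group\<^esub> g = \<one>\<^bsub>orth_group\<^esub>"
      unfolding g(1) shift_eps_mult orth_group_one id_eq_shift_eps shift_eps_inject by simp
    then have "inv\<^bsub>orth_group\<^esub> g = shift_eps a (shift a -` A)"
      using sub[OF g'] sub[OF k] by (rule group.inv_equality[OF orth_group_group])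
    then show ?thesis
      using k by simp
  qed
  show "g \<otimes>\<^bsub>orth_group\<^esub> h \<in> D1T" if gh: "g \<in> D1T" "h \<in> D1T" for g h
  proof -
    obtain a A b B where g: "g = shift_eps a A" "A \<in> RM 1" and h: "h = shift_eps b B" "B \<in> RM 1"
      using gh unfolding D1T_def by blast
    have "sym_diff (shift a -` B) A \<in> RM 1"
      by (rule RM_sym_diff[OF shift_vimage_RM1[OF h(2)] g(2)])
    then show ?thesis
      unfolding g(1) h(1) shift_eps_mult unfolding D1T_def by blast
  qed
qed

lemma D1T_group_group: "group D1T_group"
  unfolding D1T_group_def by (rule group.subgroup_imp_group[OF orth_group_group D1T_subgroup])

lemma D1T_center: "group_center D1T_group = {id, eps UNIV}"
proof (intro equalityI subsetI)
  fix z assume z: "z \<in> group_center D1T_group"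
  then obtain a A where aA: "z = shift_eps a A" "A \<in> RM 1"
    by (auto simp: group_center_def D1T_def)
  have comm: "word A $ b + word A $ 0 = word B $ a + word B $ 0" if "B \<in> RM 1" for b B
  proof -
    have "shift_eps b B \<in> D1T"
      using that by (auto simp: D1T_def)
    then have "z \<otimes>\<^bsub>orth_group\<^esub> shift_eps b B = shift_eps b B \<otimes>\<^bsub>orth_group\<^esub> z"
      using z by (simp add: group_center_def)
    then show ?thesis
      unfolding aA(1) shift_eps_commute_iff[OF aA(2) that] .
  qed
  have "a $ i = 0" for i
  proof -
    have "{x :: point. x $ i = 1} \<in> RM 1"
      by (rule RM_UNIV_coordinate) simp
    \<comment> \<open>A coordinate hyperplane without translation tests one coordinate of
      \<open>a\<close>; below, \<open>UNIV\<close> with translation \<open>b\<close> tests whether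
      \<open>A\<close> is constant.\<close>
    from comm[OF this, of 0] show ?thesis
      by (simp add: word_nth split: if_splits)
  qed
  then have a: "a = 0"
    by (simp add: vec_eq_iff)
  have "word A $ b = word A $ 0" for b
    using comm[OF RM1_UNIV, of b] by (simp add: word_nth[of UNIV])
  then have "b \<in> A \<longleftrightarrow> 0 \<in> A" for b
    by (metis Rep_bit_word)
  then have "A = {} \<or> A = UNIV"
    by blast
  then show "z \<in> {id, eps UNIV}"
    unfolding aA(1) a shift_eps_0 by auto
next
  have c: "shift_eps 0 C \<in> group_center D1T_group" if C: "C = {} \<or> C = UNIV" for C
  proof -
    have C1: "C \<in> RM 1"
      using C by auto
    have "shift_eps 0 C \<otimes>\<^bsub>orth_group\<^esub> shift_eps b B = shift_eps b B \<otimes>\<^bsub>orth_group\<^esub> shift_eps 0 C" if "B \<in> RM 1" for b B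
      unfolding shift_eps_commute_iff[OF C1 that] using C by (auto simp: word_nth[of UNIV])
    then show ?thesis
      using C1 unfolding group_center_def D1T_group_simps D1T_def by blast
  qed
  fix z assume "z \<in> {id, eps UNIV}"
  then show "z \<in> group_center D1T_group"
    using c[of "{}"] c[of UNIV] by (auto simp: shift_eps_0)
qed

lemma D1T_center_normal: "group_center D1T_group \<lhd> D1T_group"
proof -
  interpret group D1T_group
    by (rule D1T_group_group)
  let ?Z = "group_center D1T_group"
  have sub: "?Z \<subseteq> carrier D1T_group"
    by (auto simp: group_center_def)
  show ?thesis
  proof (rule normal_invI)
    show "subgroup ?Z D1T_group"
    proof (rule subgroupI)
      show "?Z \<subseteq> carrier D1T_group" "?Z \<noteq> {}"
        using sub by (auto simp: D1T_center)
      have "eps UNIV \<otimes>\<^bsub>orth_group\<^esub> eps UNIV = id"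
        by (simp add: eps_mult)
      moreover have "id \<otimes>\<^bsub>orth_group\<^esub> h = h" "h \<otimes>\<^bsub>orth_group\<^esub> id = h" for h
        by (simp_all add: orth_group_mult)
      ultimately show mult: "g \<otimes>\<^bsub>D1T_group\<^esub> h \<in> ?Z" if "g \<in> ?Z" "h \<in> ?Z" for g h
        using that unfolding D1T_center D1T_group_simps by auto
      have inv: "g \<otimes>\<^bsub>D1T_group\<^esub> g = \<one>\<^bsub>D1T_group\<^esub>" if "g \<in> ?Z" for g
        using that unfolding D1T_center D1T_group_simps by (auto simp: eps_o orth_group_mult)
      show "inv\<^bsub>D1T_group\<^esub> g \<in> ?Z" if g: "g \<in> ?Z" for g
      proof -
        have "g \<in> carrier D1T_group"
          using g sub by blast
        then have "inv\<^bsub>D1T_group\<^esub> g = g"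
          using inv[OF g] by (intro inv_equality)
        then show ?thesis
          using g by (simp only:)
      qed
    qed
    fix x h assume x: "x \<in> carrier D1T_group" and h: "h \<in> ?Z"
    have "x \<otimes>\<^bsub>D1T_group\<^esub> h = h \<otimes>\<^bsub>D1T_group\<^esub> x"
      using x h by (auto simp: group_center_def)
    moreover have "h \<in> carrier D1T_group"
      using h sub by blast
    ultimately have "x \<otimes>\<^bsub>D1T_group\<^esub> h \<otimes>\<^bsub>D1T_group\<^esub> inv\<^bsub>D1T_group\<^esub> x = h"
      using x by (simp only: m_assoc r_inv r_one inv_closed)
    then show "x \<otimes>\<^bsub>D1T_group\<^esub> h \<otimes>\<^bsub>D1T_group\<^esub> inv\<^bsub>D1T_group\<^esub> x \<in> ?Z"
      using h by simp
  qed
qed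

lemma card_D1T_center: "card (group_center D1T_group) = 2"
proof -
  have "(id :: V \<Rightarrow> V) \<noteq> eps UNIV"
    using eps_inject[of "{}" UNIV] by simp
  then show ?thesis
    by (simp add: D1T_center)
qed

text \<open>All squares lie in the centre, so the quotient has exponent 2 and is therefore also
  abelian.\<close>

lemma extraspecial_D1T_group: "extraspecial 2 D1T_group"
proof -
  let ?Z = "group_center D1T_group"
  interpret group D1T_group
    by (rule D1T_group_group)
  interpret Z: normal ?Z D1T_group
    by (rule D1T_center_normal)
  have "card (carrier (D1T_group Mod ?Z)) * card ?Z = 2 ^ 9"
    using lagrange[OF Z.is_subgroup] by (simp add: FactGroup_def order_def card_D1T)
  then have order: "order (D1T_group Mod ?Z) > 1"
    unfolding card_D1T_center order_def by simp
  have sq: "X \<otimes>\<^bsub>D1T_group Mod ?Z\<^esub> X = \<one>\<^bsub>D1T_group Mod ?Z\<^esub>" if X: "X \<in> carrier (D1T_group Mod ?Z)" for X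
  proof -
    obtain x where x: "x \<in> D1T" "X = ?Z #>\<^bsub>D1T_group\<^esub> x"
      using X by (auto simp: carrier_FactGroup)
    then have "X \<otimes>\<^bsub>D1T_group Mod ?Z\<^esub> X = ?Z #>\<^bsub>D1T_group\<^esub> (x \<otimes>\<^bsub>D1T_group\<^esub> x)"
      using Z.rcos_sum by simp
    moreover have "x \<otimes>\<^bsub>D1T_group\<^esub> x \<in> ?Z"
      using x(1) shift_eps_square unfolding D1T_center D1T_def by auto
    ultimately show ?thesis
      using Z.rcos_const by simp
  qed
  have "comm_group (D1T_group Mod ?Z)"
    using group.comm_group_if_involutions[OF Z.factorgroup_is_group sq] .
  moreover have "X [^]\<^bsub>D1T_group Mod ?Z\<^esub> (2 :: nat) = \<one>\<^bsub>D1T_group Mod ?Z\<^esub>" if X: "X \<in> carrier (D1T_group Mod ?Z)" for X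
  proof -
    interpret Q: group "D1T_group Mod ?Z"
      by (rule Z.factorgroup_is_group)
    show ?thesis
      using sq[OF X] X by (simp only: numeral_2_eq_2 Q.nat_pow_Suc Q.nat_pow_0 Q.l_one)
  qed
  ultimately have "elementary_abelian 2 (D1T_group Mod ?Z)"
    unfolding elementary_abelian_def by blast
  then show ?thesis
    unfolding extraspecial_def using order D1T_group_group card_D1T_center
    by (auto simp: order_def card_D1T intro: exI[of _ 9])
qed

text \<open>The images of \<open>D\<^sub>1\<close> form a totally singular subspace of dimension 4.\<close>

lemma plus_type_D1T_group: "plus_type D1T_group"
proof -
  let ?Z = "group_center D1T_group"
  interpret G: group D1T_group
    by (rule D1T_group_group)
  interpret Z: normal ?Z D1T_group
    by (rule D1T_center_normal)
  have D1: "D1 \<subseteq> D1T"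
    unfolding D1_def D1T_def by (auto simp flip: shift_eps_0)
  have sq: "d \<otimes>\<^bsub>orth_group\<^esub> d = id" if "d \<in> D1" for d
    using that by (auto simp: D1_def eps_mult)
  have D1_mult: "d \<otimes>\<^bsub>orth_group\<^esub> e \<in> D1" if d: "d \<in> D1" and e: "e \<in> D1" for d e
  proof -
    obtain A B where "d = eps A" "A \<in> RM 1" "e = eps B" "B \<in> RM 1"
      using d e unfolding D1_def by blast
    then show ?thesis
      unfolding D1_def using RM_sym_diff[of A 1 B] by (simp only: eps_mult imageI)
  qed
  have D1_sub: "subgroup D1 D1T_group"
  proof (rule G.subgroupI)
    show "D1 \<subseteq> carrier D1T_group"
      using D1 by simp
    show "D1 \<noteq> {}"
      unfolding D1_def using RM_empty[of 1] by blast
    show "inv\<^bsub>D1T_group\<^esub> d \<in> D1" if "d \<in> D1" for d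
    proof -
      have "inv\<^bsub>D1T_group\<^esub> d = d"
        using that D1 sq by (intro G.inv_equality) auto
      then show ?thesis
        using that by simp
    qed
  qed (simp add: D1_mult)
  have "id \<in> D1" "eps UNIV \<in> D1"
    using RM_empty[of 1] RM1_UNIV unfolding D1_def by (metis eps_empty imageI)+
  then have Z_D1: "?Z \<subseteq> D1"
    unfolding D1T_center by blast
  let ?D = "D1T_group\<lparr>carrier := D1\<rparr>"
  let ?W = "(\<lambda>d. ?Z #>\<^bsub>D1T_group\<^esub> d) ` D1"
  interpret q: group_hom D1T_group "D1T_group Mod ?Z" "\<lambda>d. ?Z #>\<^bsub>D1T_group\<^esub> d"
    by (simp only: group_hom_def group_hom_axioms_def D1T_group_group Z.factorgroup_is_group
        Z.r_coset_hom_Mod simp_thms)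
  have W: "subgroup ?W (D1T_group Mod ?Z)"
    by (rule q.subgroup_img_is_subgroup[OF D1_sub])
  \<comment> \<open>Inside the 32 sign changes the centre of order 2 has 16 cosets, and these make
    up \<open>?W\<close>.\<close>
  have "subgroup ?Z ?D"
    by (rule G.subgroup_incl[OF Z.is_subgroup D1_sub Z_D1])
  then have "card (rcosets\<^bsub>?D\<^esub> ?Z) * card ?Z = order ?D"
    by (rule group.lagrange[OF G.subgroup_imp_group[OF D1_sub]])
  moreover have "rcosets\<^bsub>?D\<^esub> ?Z = ?W"
    by (auto simp: RCOSETS_def r_coset_def)
  moreover have "order ?D = 32"
    by (simp add: order_def D1_def card_image inj_on_def card_RM1)
  ultimately have "card ?W = 2 ^ 4"
    by (simp add: card_D1T_center)
  moreover have "x \<otimes>\<^bsub>D1T_group\<^esub> x = \<one>\<^bsub>D1T_group\<^esub>" if "X \<in> ?W" "x \<in> X" for X x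
  proof -
    obtain d where "d \<in> D1" "x \<in> ?Z #>\<^bsub>D1T_group\<^esub> d"
      using \<open>X \<in> ?W\<close> \<open>x \<in> X\<close> by blast
    then have "x \<in> D1"
      using Z_D1 D1_mult by (auto simp: r_coset_def)
    then show ?thesis
      using sq by simp
  qed
  moreover have "order D1T_group = 2 ^ (1 + 2 * 4)"
    by (simp add: order_def card_D1T)
  ultimately show ?thesis
    unfolding plus_type_def using W by blast
qed

context optimism
begin

text \<open>The permutation in a signed permutation map is unique by \<open>monomial_inject\<close>,
  so the description denotes it.\<close>

definition linear_part :: "(V \<Rightarrow> V) \<Rightarrow> bit^4^4" where
  "linear_part h = affine_matrix (THE x. bij x \<and> (\<exists>A. h = perm_map x \<circ> eps A))"

lemma linear_part_monomial:
  assumes "bij x"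
  shows "linear_part (perm_map x \<circ> eps A) = affine_matrix x"
proof -
  have "(THE y. bij y \<and> (\<exists>B. perm_map x \<circ> eps A = perm_map y \<circ> eps B)) = x"
    using assms monomial_inject[OF assms] by (intro the_equality) blast+
  then show ?thesis
    by (simp only: linear_part_def)
qed

lemma linear_part_hom: "group_hom (OG_group f) GL42 linear_part"
proof (unfold group_hom_def group_hom_axioms_def, intro conjI)
  show "group (OG_group f)" "group GL42"
    by (rule OG_group_group GL42_group)+
  show "linear_part \<in> hom (OG_group f) GL42"
  proof (rule homI)
    fix g assume "g \<in> carrier (OG_group f)"
    then have "g \<in> OG f"
      by (simp add: OG_group_def)
    then obtain A x where g: "x \<in> carrier AGL42" "bij x" "g = perm_map x \<circ> eps A"
      by (rule OG_E)
    show "linear_part g \<in> carrier GL42"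
      unfolding g(3) linear_part_monomial[OF g(2)] GL42_carrier by (rule affine_matrix_invertible[OF g(1)])
  next
    fix g h assume "g \<in> carrier (OG_group f)" "h \<in> carrier (OG_group f)"
    then have gh: "g \<in> OG f" "h \<in> OG f"
      by (simp_all add: OG_group_def)
    obtain A x where g: "x \<in> carrier AGL42" "bij x" "g = perm_map x \<circ> eps A"
      using gh(1) by (rule OG_E)
    obtain B y where h: "y \<in> carrier AGL42" "bij y" "h = perm_map y \<circ> eps B"
      using gh(2) by (rule OG_E)
    have "linear_part (h \<circ> g) = linear_part g ** linear_part h"
      unfolding g(3) h(3) monomial_comp[OF g(2) h(2)] linear_part_monomial[OF g(2)]
        linear_part_monomial[OF h(2)] linear_part_monomial[OF bij_comp[OF g(2) h(2)]]
      by (rule affine_matrix_comp[OF g(1) h(1)])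
    then show "linear_part (g \<otimes>\<^bsub>OG_group f\<^esub> h) = linear_part g \<otimes>\<^bsub>GL42\<^esub> linear_part h"
      by (simp add: OG_group_def orth_group_mult GL42_mult)
  qed
qed

lemma linear_part_onto: "linear_part ` carrier (OG_group f) = carrier GL42"
proof
  show "linear_part ` carrier (OG_group f) \<subseteq> carrier GL42"
    using group_hom.hom_closed[OF linear_part_hom] by blast
  show "carrier GL42 \<subseteq> linear_part ` carrier (OG_group f)"
  proof
    fix M assume "M \<in> carrier GL42"
    then obtain x where x: "x \<in> carrier AGL42" "affine_matrix x = M"
      using affine_matrix_onto GL42_carrier by blast
    have "even_set (sym_diff {1} {act x 1})"
      using permutes_in_image[OF act_carrier(1)[OF x(1)], of 1] by (intro even_set_pair) simp_all
    then obtain A where "labelled A (sym_diff {1} {act x 1})"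
      using labelled_onto by blast
    then have "perm_map x \<circ> eps A \<in> OG f"
      by (rule OG_I[OF x(1)])
    then show "M \<in> linear_part ` carrier (OG_group f)"
      using linear_part_monomial[OF AGL42_bij[OF x(1)]] x(2) by (auto simp: OG_group_def intro!: image_eqI[rotated])
  qed
qed

text \<open>Translations act trivially on the eight points, so their labels
  \<open>{1} + {g(1)}\<close> are empty and exactly the words of \<open>RM 1\<close> occur as sign
  changes.\<close>

lemma linear_part_kernel: "kernel (OG_group f) GL42 linear_part = D1T"
proof (intro equalityI subsetI)
  fix h assume "h \<in> kernel (OG_group f) GL42 linear_part"
  then have h: "h \<in> OG f" "linear_part h = mat 1"
    by (simp_all add: kernel_def OG_group_def GL42_one)
  obtain A x where x: "x \<in> carrier AGL42" "bij x" "labelled A (sym_diff {1} {act x 1})" "h = perm_map x \<circ> eps A"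
    using h(1) by (rule OG_E)
  have t: "x \<in> translation_subgroup"
    using h(2) unfolding x(4) linear_part_monomial[OF x(2)] affine_matrix_eq_1_iff[OF x(1)] .
  then obtain a where a: "x = shift a"
    unfolding translation_subgroup_def shift_def by blast
  have "labelled A {}"
    using x(3) by (simp add: act_translation[OF t])
  then have "A \<in> RM 1"
    by (simp only: labelled_empty_iff)
  then show "h \<in> D1T"
    unfolding x(4) a D1T_def shift_eps_def by blast
next
  fix h assume "h \<in> D1T"
  then obtain a A where h: "h = perm_map (shift a) \<circ> eps A" "A \<in> RM 1"
    unfolding D1T_def shift_eps_def by blast
  have "labelled A (sym_diff {1} {act (shift a) 1})"
    using h(2) labelled_empty_iff by (simp add: act_translation[OF shift_translation])
  then have "h \<in> OG f"
    unfolding h(1) by (rule OG_I[OF shift_AGL42])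
  moreover have "linear_part h = mat 1"
    unfolding h(1) linear_part_monomial[OF shift_bij] affine_matrix_eq_1_iff[OF shift_AGL42]
    by (rule shift_translation)
  ultimately show "h \<in> kernel (OG_group f) GL42 linear_part"
    by (simp add: kernel_def OG_group_def GL42_one)
qed

text \<open>\<open>D1T\<close> is itself a normal 2-subgroup and contains all the others, so the
  generating union is already this subgroup.\<close>

lemma O2_OG_eq: "O2_OG f = D1T"
proof -
  interpret l: group_hom "OG_group f" GL42 linear_part
    by (rule linear_part_hom)
  let ?F = "{N. N \<lhd> OG_group f \<and> (\<exists>k. card N = 2 ^ k)}"
  have normal: "D1T \<lhd> OG_group f"
    using l.normal_kernel unfolding linear_part_kernel .
  have "N \<subseteq> D1T" if "N \<in> ?F" for N
    using that normal_two_subgroup_subset_kernel[OF linear_part_hom linear_part_onto]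
    unfolding linear_part_kernel by blast
  then have "\<Union>?F \<subseteq> D1T"
    by blast
  moreover have "D1T \<in> ?F"
    using normal card_D1T by blast
  ultimately have "\<Union>?F = D1T"
    by blast
  moreover have "generate (OG_group f) D1T = D1T"
  proof
    show "generate (OG_group f) D1T \<subseteq> D1T"
      by (rule l.G.generate_subgroup_incl[OF subset_refl normal_imp_subgroup[OF normal]])
    show "D1T \<subseteq> generate (OG_group f) D1T"
      by (rule subsetI) (rule generate.incl)
  qed
  ultimately show ?thesis
    unfolding O2_OG_def p_core_def by simp
qed

lemma optimism_group_structure:
  "extraspecial 2 (OG_group f\<lparr>carrier := O2_OG f\<rparr>)"
  "card (O2_OG f) = 2 ^ 9"
  "plus_type (OG_group f\<lparr>carrier := O2_OG f\<rparr>)"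
  "OG_group f Mod O2_OG f \<cong> GL42"
proof -
  have eq: "OG_group f\<lparr>carrier := O2_OG f\<rparr> = D1T_group"
    unfolding O2_OG_eq by (simp add: OG_group_def D1T_group_def)
  show "extraspecial 2 (OG_group f\<lparr>carrier := O2_OG f\<rparr>)" "plus_type (OG_group f\<lparr>carrier := O2_OG f\<rparr>)"
    unfolding eq by (rule extraspecial_D1T_group plus_type_D1T_group)+
  show "card (O2_OG f) = 2 ^ 9"
    unfolding O2_OG_eq by (rule card_D1T)
  show "OG_group f Mod O2_OG f \<cong> GL42"
    using group_hom.FactGroup_iso_set[OF linear_part_hom linear_part_onto]
    unfolding O2_OG_eq linear_part_kernel is_iso_def by blast
qed

end

theorem theorem6p13:
  fixes \<phi> :: "(point \<Rightarrow> point) set \<Rightarrow> nat \<Rightarrow> nat"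
    and \<psi> :: "(V \<Rightarrow> V) set \<Rightarrow> nat set set"
    and f :: "(point \<Rightarrow> point) \<Rightarrow> V \<Rightarrow> V"
  assumes "alt_identification \<phi>"
    and "module_identification \<phi> \<psi>"
    and "optimism_map \<phi> \<psi> f"
  shows "{h. orthogonal_transformation h \<and> h ` OC f = OC f} = OG f
    \<and> group (OG_group f)
    \<and> extraspecial 2 (OG_group f\<lparr>carrier := O2_OG f\<rparr>)
    \<and> card (O2_OG f) = 2 ^ 9
    \<and> plus_type (OG_group f\<lparr>carrier := O2_OG f\<rparr>)
    \<and> OG_group f Mod O2_OG f \<cong> GL42"
proof -
  interpret optimism \<phi> \<psi> f
    using assms by unfold_locales
  show ?thesis
    by (intro conjI stabilizer_eq_OG OG_group_group optimism_group_structure)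
qed

end
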